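(* Let $p$ be odd, and let $\alpha_1,\alpha_2,\alpha_3\in\mathbb{F}_{p^m}^*$ and $\alpha_4\in\mathbb{F}_{p^m}$ be such that $\alpha=\alpha_1+\alpha_2u+\alpha_3v+\alpha_4uv$ is not a cube in $\mathcal{R}$. Let $\mathcal{C}=\langle(x^3-\alpha_0)^\ell+u(x^3-\alpha_0)^tz(x),\,u(x^3-\alpha_0)^\mu\rangle\subseteq\frac{\mathcal{R}[x]}{\langle x^{3p^s}-\alpha\rangle}$, where $0\le\ell\le2p^s-1$, $0\le t<\ell$, $z(x)$ is $0$ or invertible, and $0\le\mu<\Im$, where $\Im=\min\{\ell,p^s\}$ if $z(x)=0$; $\Im=\min\{\ell,p^s,2p^s-\ell+t\}$ if $z(x)\neq0$ and $\ell\neq p^s+t$; and $\Im=p^s$ if $z(x)\ne0$ and $\ell=p^s+t$. If $z(x)$ is invertible, write $z(x)=\sum_{\kappa=0}^{\mu-t-1}(z_{0\kappa}x^2+z_{1\kappa}x+z_{2\kappa})(x^3-\alpha_0)^\kappa$ with $z_{0\kappa},z_{1\kappa},z_{2\kappa}\in\mathbb{F}_{p^m}$ and $z_{00}x^2+z_{10}x+z_{20}\ne0$. Then the dual code $\mathcal{C}^\perp$, associated to the ideal $\mathcal{A}(\mathcal{C})^*$ of $\frac{\mathcal{R}[x]}{\langle x^{3p^s}-\alpha^{-1}\rangle}$, is determined as follows. 1. If $z(x)=0$ and $1\le\ell\le p^s$, then $\mathcal{A}(\mathcal{C})^*=\langle\psi_1^*(x),\,u(x^3-\alpha_0^{-1})^{2p^s-\ell}\rangle$,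 where $$\psi_1^*(x)=(-\alpha_0)^{2p^s-\mu}(x^3-\alpha_0^{-1})^{2p^s-\mu}-2\alpha_2u(-\alpha_0)^{p^s-\mu}(x^3-\alpha_0^{-1})^{p^s-\mu}x^{3p^s}.$$ 2. If $z(x)$ is invertible and $\ell\ne p^s+t$, then $\mathcal{A}(\mathcal{C})^*=\langle\psi_2^*(x),\,u(x^3-\alpha_0^{-1})^{2p^s-\ell}\rangle$, where $$\begin{aligned}\psi_2^*(x)=\;&(-\alpha_0)^{2p^s-\mu}(x^3-\alpha_0^{-1})^{2p^s-\mu}-2\alpha_2u(-\alpha_0)^{p^s-\mu}(x^3-\alpha_0^{-1})^{p^s-\mu}x^{3p^s}\\&-u(-\alpha_0)^{2p^s+t-\ell-\mu}(x^3-\alpha_0^{-1})^{2p^s+t-\ell-\mu}\sum_{\kappa=0}^{\mu-t-1}(z_{2\kappa}x^2+z_{1\kappa}x+z_{0\kappa})(-\alpha_0)^\kappa(x^3-\alpha_0^{-1})^\kappa x^{3\ell-3t-3\kappa-2}.\end{aligned}$$ 3. If $z(x)$ is invertible and $\ell=p^s+t$, then $\mathcal{A}(\mathcal{C})^*=\langle\psi_4^*(x),\,u(x^3-\alpha_0^{-1})^{2p^s-\ell}\rangle$, where $$\begin{aligned}\psi_4^*(x)=\;&(-\alpha_0)^{2p^s-\mu}(x^3-\alpha_0^{-1})^{2p^s-\mu}-2\alpha_2u(-\alpha_0)^{p^s-\mu}(x^3-\alpha_0^{-1})^{p^s-\mu}x^{3p^s}\\&-u(-\alpha_0)^{2p^s+t-\ell-\mu}(x^3-\alpha_0^{-1})^{2p^s+t-\ell-\mu}\sum_{\kappa=0}^{\mu-t-1}(z_{2\kappa}x^2+z_{1\kappa}x+z_{0\kappa})(-\alpha_0)^\kappa(x^3-\alpha_0^{-1})^\kappa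 x^{3\ell-3t-3\kappa-2}.\end{aligned}$$
   Context: $p\neq3$ is a prime, $m,s$ are positive integers, and $\mathcal{R}=\frac{\mathbb{F}_{p^m}[u,v]}{\langle u^2,v^2,uv-vu\rangle}=\mathbb{F}_{p^m}+u\mathbb{F}_{p^m}+v\mathbb{F}_{p^m}+uv\mathbb{F}_{p^m}$ with $u^2=v^2=0$, $uv=vu$. Writing $s=q_0m+r_0$ with $q_0\ge0$ and $0\le r_0\le m-1$, put $\alpha_0=\alpha_1^{p^{m-r_0}}$, so that $\alpha_0^{p^s}=\alpha_1$. Constacyclic codes of length $n=3p^s$ are identified with ideals via $(c_0,\dots,c_{n-1})\mapsto\sum c_ix^i$; $\mathcal{C}^\perp$ is the dual for the standard inner product on $\mathcal{R}^n$. For an ideal $\mathcal{C}$ of $\frac{\mathcal{R}[x]}{\langle x^{3p^s}-\alpha\rangle}$, $\mathcal{A}(\mathcal{C})$ is its annihilator; the reciprocal of a polynomial $f$ of degree $k$ is $f^*(x)=x^kf(x^{-1})$ ($0^*=0$), and $\mathcal{A}(\mathcal{C})^*=\{f^*(x): f(x)\in\mathcal{R}[x]\text{ represents an element of }\mathcal{A}(\mathcal{C})\}$, viewed in $\frac{\mathcal{R}[x]}{\langle x^{3p^s}-\alpha^{-1}\rangle}$. One has $\mathcal{C}^\perp=\mathcal{A}(\mathcal{C})^*$. *)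

theory Defs
  imports "HOL-Algebra.Algebraic_Closure_Type" "HOL-Library.Cardinality"
begin

section \<open>The ring \<open>\<R> = F[u,v]/\<langle>u\<^sup>2, v\<^sup>2, uv - vu\<rangle>\<close>\<close>

text \<open>
  \<open>UV a b c d\<close> stands for \<open>a + b u + c v + d uv\<close>.  Lemma \<open>uvring_iso\<close> below shows that this
  is the quotient of the polynomial ring in two commuting variables by \<open>\<langle>u\<^sup>2, v\<^sup>2\<rangle>\<close>.
\<close>

datatype 'a uvring = UV (uv_1: 'a) (uv_u: 'a) (uv_v: 'a) (uv_uv: 'a)

instantiation uvring :: (comm_ring_1) comm_ring_1
begin

definition zero_uvring :: "'a uvring" where "0 = UV 0 0 0 0"

definition one_uvring :: "'a uvring" where "1 = UV 1 0 0 0"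

fun plus_uvring :: "'a uvring \<Rightarrow> 'a uvring \<Rightarrow> 'a uvring" where
  "UV a b c d + UV a' b' c' d' = UV (a + a') (b + b') (c + c') (d + d')"

fun uminus_uvring :: "'a uvring \<Rightarrow> 'a uvring" where
  "- UV a b c d = UV (- a) (- b) (- c) (- d)"

definition minus_uvring :: "'a uvring \<Rightarrow> 'a uvring \<Rightarrow> 'a uvring" where
  "r - r' = r + - (r' :: 'a uvring)"

fun times_uvring :: "'a uvring \<Rightarrow> 'a uvring \<Rightarrow> 'a uvring" where
  "UV a b c d * UV a' b' c' d' =
     UV (a * a') (a * b' + b * a') (a * c' + c * a') (a * d' + b * c' + c * b' + d * a')"

instance
proof
  fix x y z :: "'a uvring"
  show "x + y + z = x + (y + z)"
    by (cases x; cases y; cases z) (simp add: algebra_simps)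
  show "x + y = y + x"
    by (cases x; cases y) (simp add: algebra_simps)
  show "0 + x = x"
    by (cases x) (simp add: zero_uvring_def)
  show "- x + x = 0"
    by (cases x) (simp add: zero_uvring_def)
  show "x - y = x + - y"
    by (simp add: minus_uvring_def)
  show "x * y * z = x * (y * z)"
    by (cases x; cases y; cases z) (simp add: algebra_simps)
  show "x * y = y * x"
    by (cases x; cases y) (simp add: algebra_simps)
  show "1 * x = x"
    by (cases x) (simp add: one_uvring_def)
  show "(x + y) * z = x * z + y * z"
    by (cases x; cases y; cases z) (simp add: algebra_simps)
  show "(0 :: 'a uvring) \<noteq> 1"
    by (simp add: zero_uvring_def one_uvring_def)
qed

end

definition uv_const :: "'a::comm_ring_1 \<Rightarrow> 'a uvring" where
  "uv_const a = UV a 0 0 0"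

definition uu :: "'a::comm_ring_1 uvring" where "uu = UV 0 1 0 0"

definition vv :: "'a::comm_ring_1 uvring" where "vv = UV 0 0 1 0"

lemma UV_eq: "UV a b c d = uv_const a + uv_const b * uu + uv_const c * vv + uv_const d * uu * vv"
  by (simp add: uv_const_def uu_def vv_def)

text \<open>Polynomials in \<open>u\<close> (outer variable) over polynomials in \<open>v\<close> (inner variable).\<close>

definition uv_proj :: "'a::comm_ring_1 poly poly \<Rightarrow> 'a uvring" where
  "uv_proj P = UV (Polynomial.coeff (Polynomial.coeff P 0) 0) (Polynomial.coeff (Polynomial.coeff P 1) 0)
                  (Polynomial.coeff (Polynomial.coeff P 0) 1) (Polynomial.coeff (Polynomial.coeff P 1) 1)"

lemma uvring_iso:
  fixes F2 :: "'a::comm_ring_1 poly poly ring"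
  defines "F2 \<equiv> ring_of_type_algebra"
  shows "(\<lambda>A. the_elem (uv_proj ` A)) \<in>
           ring_iso (F2 Quot genideal F2 {[:0, 1:]\<^sup>2, [:[:0, 1:]:]\<^sup>2})
                    (ring_of_type_algebra :: 'a uvring ring)"
proof -
  let ?R = "ring_of_type_algebra :: 'a uvring ring"
  have cF: "cring F2" unfolding F2_def by (rule cring_from_type_algebra)
  have cR: "cring ?R" by (rule cring_from_type_algebra)
  interpret F2: cring F2 by (rule cF)
  interpret R: cring ?R by (rule cR)
  have mult1: "Polynomial.coeff (p * q) 1 =
      Polynomial.coeff p 0 * Polynomial.coeff q 1 + Polynomial.coeff p 1 * Polynomial.coeff q 0"
    for p q :: "'b::comm_ring_1 poly"
    by (simp add: coeff_mult)
  have mult0: "Polynomial.coeff (p * q) 0 = Polynomial.coeff p 0 * Polynomial.coeff q 0"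
    for p q :: "'b::comm_ring_1 poly"
    by (simp add: coeff_mult)
  have hmult: "uv_proj (P * Q) = uv_proj P * uv_proj Q" for P Q :: "'a poly poly"
    unfolding uv_proj_def mult0 mult1 coeff_add by (simp add: algebra_simps)
  have hadd: "uv_proj (P + Q) = uv_proj P + uv_proj Q" for P Q :: "'a poly poly"
    by (simp add: uv_proj_def)
  have hone: "uv_proj (1 :: 'a poly poly) = 1"
    by (simp add: uv_proj_def one_uvring_def)
  have hom: "uv_proj \<in> ring_hom F2 ?R"
    by (rule ring_hom_memI) (simp_all add: F2_def ring_of_type_algebra_def hmult hadd hone)
  interpret h: ring_hom_ring F2 ?R uv_proj
    by (rule ring_hom_ringI2) (use F2.ring_axioms R.ring_axioms hom in auto)
  have surj: "uv_proj ` carrier F2 = carrier ?R"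
  proof -
    have "r = uv_proj [:[:uv_1 r, uv_v r:], [:uv_u r, uv_uv r:]:]" for r :: "'a uvring"
      by (cases r) (simp add: uv_proj_def)
    then show ?thesis
      by (auto simp: F2_def ring_of_type_algebra_def)
  qed
  have carr: "x \<in> carrier F2" for x by (simp add: F2_def ring_of_type_algebra_def)
  have zeroR: "\<zero>\<^bsub>?R\<^esub> = 0" by (simp add: ring_of_type_algebra_def)
  let ?S = "{[:0, 1:]\<^sup>2, [:[:0, 1:]:]\<^sup>2} :: 'a poly poly set"
  have idS: "ideal (genideal F2 ?S) F2"
    by (rule F2.genideal_ideal) (use carr in auto)
  have ker: "a_kernel F2 ?R uv_proj = genideal F2 ?S"
  proof
    have "?S \<subseteq> a_kernel F2 ?R uv_proj"
      by (auto simp: a_kernel_def' F2_def ring_of_type_algebra_def uv_proj_def zero_uvring_def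
          power2_eq_square)
    then show "genideal F2 ?S \<subseteq> a_kernel F2 ?R uv_proj"
      by (intro F2.genideal_minimal h.kernel_is_ideal)
  next
    show "a_kernel F2 ?R uv_proj \<subseteq> genideal F2 ?S"
    proof
      fix P assume "P \<in> a_kernel F2 ?R uv_proj"
      then have z: "uv_proj P = 0"
        unfolding a_kernel_def' by (simp only: zeroR mem_Collect_eq)
      have split: "\<exists>a b r. p = [:a, b:] + [:0, 1:]\<^sup>2 * r" for p :: "'b::comm_ring_1 poly"
      proof -
        obtain a p' where p: "p = pCons a p'" by (cases p)
        obtain b r where "p' = pCons b r" by (cases p')
        with p have "p = [:a, b:] + [:0, 1:]\<^sup>2 * r" by (simp add: power2_eq_square)
        then show ?thesis by blast
      qed
      obtain p0 p1 r where P: "P = [:p0, p1:] + [:0, 1:]\<^sup>2 * r" using split by blast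
      obtain a0 b0 r0 where p0: "p0 = [:a0, b0:] + [:0, 1:]\<^sup>2 * r0" using split by blast
      obtain a1 b1 r1 where p1: "p1 = [:a1, b1:] + [:0, 1:]\<^sup>2 * r1" using split by blast
      have "a0 = 0" "b0 = 0" "a1 = 0" "b1 = 0"
        using z by (simp_all add: P p0 p1 uv_proj_def zero_uvring_def power2_eq_square)
      then have eq: "P = [:r0, r1:] * [:[:0, 1:]:]\<^sup>2 + r * [:0, 1:]\<^sup>2"
        by (simp add: P p0 p1 power2_eq_square)
      interpret I: ideal "genideal F2 ?S" F2 by (rule idS)
      have mem: "s \<in> genideal F2 ?S" if "s \<in> ?S" for s
        using F2.genideal_self[of ?S] that carr by blast
      have m: "x * s \<in> genideal F2 ?S" if "s \<in> ?S" for x s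
        using I.I_l_closed[OF mem[OF that] carr[of x]] by (simp add: F2_def ring_of_type_algebra_def)
      have a: "x + y \<in> genideal F2 ?S" if "x \<in> genideal F2 ?S" "y \<in> genideal F2 ?S" for x y
        using I.a_closed[OF that] by (simp add: F2_def ring_of_type_algebra_def)
      show "P \<in> genideal F2 ?S"
        unfolding eq by (intro a m) auto
    qed
  qed
  show ?thesis
    using h.FactRing_iso_set[OF surj] unfolding ker .
qed


section \<open>Constacyclic codes over a commutative ring\<close>

definition consta_modulus :: "nat \<Rightarrow> 'r::comm_ring_1 \<Rightarrow> 'r poly" where
  "consta_modulus n a = Polynomial.monom 1 n - [:a:]"

definition consta_ring :: "nat \<Rightarrow> 'r::comm_ring_1 \<Rightarrow> 'r poly set ring" where
  "consta_ring n a =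
     ring_of_type_algebra Quot cgenideal ring_of_type_algebra (consta_modulus n a)"

definition consta_class :: "nat \<Rightarrow> 'r::comm_ring_1 \<Rightarrow> 'r poly \<Rightarrow> 'r poly set" where
  "consta_class n a f =
     a_r_coset ring_of_type_algebra (cgenideal ring_of_type_algebra (consta_modulus n a)) f"

definition consta_ideal :: "nat \<Rightarrow> 'r::comm_ring_1 \<Rightarrow> 'r poly set \<Rightarrow> 'r poly set set" where
  "consta_ideal n a S = genideal (consta_ring n a) (consta_class n a ` S)"

text \<open>The word \<open>(c\<^sub>0, \<dots>, c\<^sub>n\<^sub>-\<^sub>1)\<close> is identified with the class of \<open>\<Sum>c\<^sub>i x\<^sup>i\<close>.\<close>

definition consta_code :: "nat \<Rightarrow> 'r::comm_ring_1 \<Rightarrow> 'r poly set set \<Rightarrow> 'r list set" where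
  "consta_code n a I = {c. length c = n \<and> consta_class n a (Poly c) \<in> I}"

definition dual_code :: "nat \<Rightarrow> 'r::comm_ring_1 list set \<Rightarrow> 'r list set" where
  "dual_code n D = {d. length d = n \<and> (\<forall>c\<in>D. (\<Sum>i<n. c ! i * d ! i) = 0)}"

definition annihilator :: "('x, 'y) ring_scheme \<Rightarrow> 'x set \<Rightarrow> 'x set" where
  "annihilator Q I = {a \<in> carrier Q. \<forall>c\<in>I. a \<otimes>\<^bsub>Q\<^esub> c = \<zero>\<^bsub>Q\<^esub>}"

definition unit_inv :: "'r::comm_ring_1 \<Rightarrow> 'r" where
  "unit_inv a = inv\<^bsub>ring_of_type_algebra\<^esub> a"

text \<open>
  \<open>\<A>(I)\<^sup>*\<close>, a subset of \<open>R[x]/\<langle>x\<^sup>n - a\<^sup>-\<^sup>1\<rangle>\<close> for an ideal \<open>I\<close> of \<open>R[x]/\<langle>x\<^sup>n - a\<rangle>\<close>.  The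
  reciprocals of \<^emph>\<open>all\<close> polynomials representing an element of \<open>\<A>(I)\<close> are taken, since the
  reciprocal depends on the degree of the representative.
\<close>

definition annihilator_star :: "nat \<Rightarrow> 'r::comm_ring_1 \<Rightarrow> 'r poly set set \<Rightarrow> 'r poly set set" where
  "annihilator_star n a I =
     {consta_class n (unit_inv a) (reflect_poly f) | f.
        consta_class n a f \<in> annihilator (consta_ring n a) I}"


section \<open>Polynomials over \<open>\<R>\<close>\<close>

definition cP :: "'a::comm_ring_1 \<Rightarrow> 'a uvring poly" where
  "cP a = [:uv_const a:]"

definition uP :: "'a::comm_ring_1 uvring poly" where
  "uP = [:uu:]"

definition xP :: "'a::comm_ring_1 uvring poly" where
  "xP = Polynomial.monom 1 1"

text \<open>
  In \<open>psi1\<close>, \<open>psi2\<close>, \<open>psi4\<close> the argument \<open>q\<close> is \<open>p\<^sup>s\<close>; \<open>a0\<close>, \<open>a2\<close> are \<open>\<alpha>\<^sub>0\<close>, \<open>\<alpha>\<^sub>2\<close>.  No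
  truncated subtraction takes effect under the bounds on \<open>l\<close>, \<open>t\<close>, \<open>mu\<close> of the theorem.
  The formulas for \<open>psi2\<close> and \<open>psi4\<close> agree; they belong to different cases.
\<close>

definition psi1 :: "nat \<Rightarrow> 'a::field \<Rightarrow> 'a \<Rightarrow> nat \<Rightarrow> 'a uvring poly" where
  "psi1 q a0 a2 mu =
     cP ((- a0) ^ (2 * q - mu)) * (xP ^ 3 - cP (inverse a0)) ^ (2 * q - mu)
     - 2 * cP a2 * uP * cP ((- a0) ^ (q - mu)) * (xP ^ 3 - cP (inverse a0)) ^ (q - mu) * xP ^ (3 * q)"

definition psi2 :: "nat \<Rightarrow> 'a::field \<Rightarrow> 'a \<Rightarrow> nat \<Rightarrow> nat \<Rightarrow> nat \<Rightarrow>
    (nat \<Rightarrow> 'a) \<Rightarrow> (nat \<Rightarrow> 'a) \<Rightarrow> (nat \<Rightarrow> 'a) \<Rightarrow> 'a uvring poly" where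
  "psi2 q a0 a2 l t mu z0 z1 z2 =
     cP ((- a0) ^ (2 * q - mu)) * (xP ^ 3 - cP (inverse a0)) ^ (2 * q - mu)
     - 2 * cP a2 * uP * cP ((- a0) ^ (q - mu)) * (xP ^ 3 - cP (inverse a0)) ^ (q - mu) * xP ^ (3 * q)
     - uP * cP ((- a0) ^ (2 * q + t - l - mu)) * (xP ^ 3 - cP (inverse a0)) ^ (2 * q + t - l - mu)
         * (\<Sum>k<mu - t. (cP (z2 k) * xP\<^sup>2 + cP (z1 k) * xP + cP (z0 k))
              * cP ((- a0) ^ k) * (xP ^ 3 - cP (inverse a0)) ^ k * xP ^ (3 * l - 3 * t - 3 * k - 2))"

definition psi4 :: "nat \<Rightarrow> 'a::field \<Rightarrow> 'a \<Rightarrow> nat \<Rightarrow> nat \<Rightarrow> nat \<Rightarrow>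
    (nat \<Rightarrow> 'a) \<Rightarrow> (nat \<Rightarrow> 'a) \<Rightarrow> (nat \<Rightarrow> 'a) \<Rightarrow> 'a uvring poly" where
  "psi4 q a0 a2 l t mu z0 z1 z2 =
     cP ((- a0) ^ (2 * q - mu)) * (xP ^ 3 - cP (inverse a0)) ^ (2 * q - mu)
     - 2 * cP a2 * uP * cP ((- a0) ^ (q - mu)) * (xP ^ 3 - cP (inverse a0)) ^ (q - mu) * xP ^ (3 * q)
     - uP * cP ((- a0) ^ (2 * q + t - l - mu)) * (xP ^ 3 - cP (inverse a0)) ^ (2 * q + t - l - mu)
         * (\<Sum>k<mu - t. (cP (z2 k) * xP\<^sup>2 + cP (z1 k) * xP + cP (z0 k))
              * cP ((- a0) ^ k) * (xP ^ 3 - cP (inverse a0)) ^ k * xP ^ (3 * l - 3 * t - 3 * k - 2))"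

end

theory Submission imports Defs begin

text \<open>
  Write \<open>q = p\<^sup>s\<close>, \<open>n = 3q\<close> and \<open>w = x\<^sup>3 - \<alpha>\<^sub>0\<close>.  The choice of \<open>\<alpha>\<^sub>0\<close> and the Frobenius map give
  \<open>w\<^sup>q = x\<^sup>n - \<alpha>\<^sub>1\<close>, so that \<open>w\<^sup>q = \<alpha>\<^sub>2 u + \<alpha>\<^sub>3 v + \<alpha>\<^sub>4 uv\<close> modulo \<open>x\<^sup>n - \<alpha>\<close>.  As \<open>\<alpha>\<^sub>3\<close> is a unit,
  this equation can be solved for \<open>v\<close>.  Hence every class has the form \<open>f + u g\<close> with
  \<open>f, g \<in> F[x]\<close> (\<open>u_form\<close>), squaring gives \<open>w\<^bsup>2q\<^esup> = 2\<alpha>\<^sub>2 u w\<^sup>q\<close> (\<open>W0_sq\<close>), and \<open>u f = 0\<close> holds exactly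
  when \<open>w\<^bsup>2q\<^esup>\<close> divides \<open>f\<close> (\<open>u_base_dvd_iff\<close>).

  In this description the annihilator of \<open>\<langle>w\<^sup>l + u w\<^sup>t z, u w\<^sup>\<mu>\<rangle>\<close> is found by hand
  (\<open>annihilator_generators\<close>).  Put
  \<open>G = w\<^bsup>2q-\<mu>\<^esup> - 2\<alpha>\<^sub>2 u w\<^bsup>q-\<mu>\<^esup> - u w\<^bsup>2q+t-l-\<mu>\<^esup> z\<close>.  The terms in \<open>z\<close> cancel in
  \<open>G (w\<^sup>l + u w\<^sup>t z) = w\<^bsup>l-\<mu>\<^esup> (w\<^bsup>2q\<^esup> - 2\<alpha>\<^sub>2 u w\<^sup>q) = 0\<close>.  Conversely, if \<open>f + u g\<close> annihilates the code,
  then it kills \<open>u w\<^sup>\<mu>\<close>, which makes \<open>f\<close> a multiple of \<open>w\<^bsup>2q-\<mu>\<^esup>\<close>; subtracting a multiple of \<open>G\<close>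
  leaves an element \<open>u g'\<close>, and this kills \<open>w\<^sup>l + u w\<^sup>t z\<close> only if \<open>w\<^bsup>2q-l\<^esup>\<close> divides \<open>g'\<close>.  So the
  annihilator is \<open>\<langle>G, u w\<^bsup>2q-l\<^esup>\<rangle>\<close>, whichever of the cases of the theorem applies.

  The reciprocal of a polynomial \<open>f\<close> represents \<open>x\<^bsup>deg f\<^esup> f(x\<^sup>-\<^sup>1)\<close> modulo \<open>x\<^sup>n - \<alpha>\<^sup>-\<^sup>1\<close>.  Since \<open>x\<close> is a
  unit there, taking reciprocals of all representatives of an ideal yields precisely its image
  under the isomorphism \<open>x \<mapsto> x\<^sup>-\<^sup>1\<close> (\<open>consta_class_in_star_iff\<close>).  The image of \<open>G\<close>, multiplied by
  the unit \<open>x\<^bsup>3(2q-\<mu>)\<^esup>\<close>, is the polynomial \<open>\<psi>\<close> of the theorem, and \<open>u w\<^bsup>2q-l\<^esup>\<close> goes to a unit multiple of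
  \<open>u (x\<^sup>3 - \<alpha>\<^sub>0\<^sup>-\<^sup>1)\<^bsup>2q-l\<^esup>\<close>.

  Finally, the dual code is \<open>\<A>(C)\<^sup>*\<close> for every constacyclic code \<open>C\<close>
  (\<open>dual_code_eq_annihilator_star\<close>): the inner product of \<open>c\<close> and \<open>d\<close> is the constant term of
  \<open>c(x) d(x\<^sup>-\<^sup>1)\<close>, and multiplying \<open>c\<close> by powers of \<open>x\<close> reads off every other coefficient.
\<close>


section \<open>Congruence of polynomials\<close>

definition eqmod :: "'r::comm_ring_1 poly \<Rightarrow> 'r poly \<Rightarrow> 'r poly \<Rightarrow> bool" where
  "eqmod m f g \<longleftrightarrow> m dvd f - g"

lemma eqmod_refl [simp]: "eqmod m f f"
  by (simp add: eqmod_def)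

lemma eqmod_sym: "eqmod m f g \<Longrightarrow> eqmod m g f"
  unfolding eqmod_def by (metis dvd_minus_iff minus_diff_eq)

lemma eqmod_trans [trans]: "eqmod m f g \<Longrightarrow> eqmod m g h \<Longrightarrow> eqmod m f h"
  unfolding eqmod_def using dvd_add[of m "f - g" "g - h"] by simp

lemma eqmod_add: "eqmod m f g \<Longrightarrow> eqmod m f' g' \<Longrightarrow> eqmod m (f + f') (g + g')"
  unfolding eqmod_def using dvd_add[of m "f - g" "f' - g'"] by (simp add: algebra_simps)

lemma eqmod_diff: "eqmod m f g \<Longrightarrow> eqmod m f' g' \<Longrightarrow> eqmod m (f - f') (g - g')"
  unfolding eqmod_def using dvd_diff[of m "f - g" "f' - g'"] by (simp add: algebra_simps)

lemma eqmod_mult: "eqmod m f g \<Longrightarrow> eqmod m f' g' \<Longrightarrow> eqmod m (f * f') (g * g')"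
proof -
  assume "eqmod m f g" "eqmod m f' g'"
  then have "m dvd (f - g) * f' + g * (f' - g')"
    unfolding eqmod_def by (intro dvd_add dvd_mult dvd_mult2) auto
  then show ?thesis unfolding eqmod_def by (simp add: algebra_simps)
qed

lemma eqmod_power: "eqmod m f g \<Longrightarrow> eqmod m (f ^ k) (g ^ k)"
  by (induction k) (auto intro: eqmod_mult)

lemma eqmod_sum: "(\<And>i. i \<in> A \<Longrightarrow> eqmod m (f i) (g i)) \<Longrightarrow> eqmod m (sum f A) (sum g A)"
  by (induction A rule: infinite_finite_induct) (auto intro: eqmod_add)

lemma eqmod_0_iff: "eqmod m f 0 \<longleftrightarrow> m dvd f"
  by (simp add: eqmod_def)

lemma eqmod_dvd: "eqmod m f g \<Longrightarrow> m dvd f \<longleftrightarrow> m dvd g"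
  using eqmod_0_iff eqmod_sym eqmod_trans by metis


section \<open>Quotient rings, ideals and annihilators in terms of congruences\<close>

lemma consta_class_conv:
  "consta_class n a f = {h. eqmod (consta_modulus n a) h f}"
proof -
  have "consta_class n a f = {x * consta_modulus n a + f | x. True}"
    unfolding consta_class_def a_r_coset_def' cgenideal_def ring_of_type_algebra_def by auto
  also have "\<dots> = {h. eqmod (consta_modulus n a) h f}"
    by (auto simp: eqmod_def dvd_def algebra_simps eq_diff_eq)
  finally show ?thesis .
qed

lemma consta_class_eq_iff:
  "consta_class n a f = consta_class n a g \<longleftrightarrow> eqmod (consta_modulus n a) f g"
  unfolding consta_class_conv using eqmod_refl eqmod_sym eqmod_trans by blast

lemma consta_ideal_modulus:
  fixes a :: "'r::comm_ring_1"
  shows "ideal (cgenideal ring_of_type_algebra (consta_modulus n a)) ring_of_type_algebra"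
proof -
  interpret cring "ring_of_type_algebra :: 'r poly ring" by (rule cring_from_type_algebra)
  show ?thesis
    by (rule cgenideal_ideal) (simp add: ring_of_type_algebra_def)
qed

lemma consta_ring_cring: "cring (consta_ring n a)"
  unfolding consta_ring_def
  by (rule ideal.quotient_is_cring[OF consta_ideal_modulus]) (rule cring_from_type_algebra)

lemma consta_class_hom:
  "consta_class n a \<in> ring_hom ring_of_type_algebra (consta_ring n a)"
  using ideal.rcos_ring_hom[OF consta_ideal_modulus, of n a]
  unfolding consta_ring_def consta_class_def[abs_def] .

lemma consta_class_add:
  "consta_class n a f \<oplus>\<^bsub>consta_ring n a\<^esub> consta_class n a g = consta_class n a (f + g)"
  using ring_hom_add[OF consta_class_hom, of f g n a] by (simp add: ring_of_type_algebra_def)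

lemma consta_class_mult:
  "consta_class n a f \<otimes>\<^bsub>consta_ring n a\<^esub> consta_class n a g = consta_class n a (f * g)"
  using ring_hom_mult[OF consta_class_hom, of f g n a] by (simp add: ring_of_type_algebra_def)

lemma consta_class_one: "\<one>\<^bsub>consta_ring n a\<^esub> = consta_class n a 1"
  using ring_hom_one[OF consta_class_hom, of n a] by (simp add: ring_of_type_algebra_def)

lemma consta_ring_carrier: "carrier (consta_ring n a) = range (consta_class n a)"
  unfolding consta_ring_def FactRing_simps consta_class_def by (auto simp: ring_of_type_algebra_def)

lemma consta_class_zero: "\<zero>\<^bsub>consta_ring n a\<^esub> = consta_class n a 0"
proof -
  interpret Q: cring "consta_ring n a" by (rule consta_ring_cring)
  have "consta_class n a 0 \<oplus>\<^bsub>consta_ring n a\<^esub> consta_class n a 0 = consta_class n a 0"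
    by (simp add: consta_class_add)
  then show ?thesis
    by (metis Q.add.r_cancel_one' consta_ring_carrier rangeI)
qed

lemma consta_ideal_two_gens:
  "consta_ideal n a {g, h} = {consta_class n a (A * g + B * h) | A B. True}" (is "_ = ?J")
proof -
  interpret Q: cring "consta_ring n a" by (rule consta_ring_cring)
  have sub: "consta_class n a ` {g, h} \<subseteq> carrier (consta_ring n a)"
    by (auto simp: consta_ring_carrier)
  interpret I: ideal "consta_ideal n a {g, h}" "consta_ring n a"
    unfolding consta_ideal_def by (rule Q.genideal_ideal[OF sub])
  have J: "ideal ?J (consta_ring n a)"
  proof (rule idealI)
    show "subgroup ?J (add_monoid (consta_ring n a))"
    proof (rule subgroup.intro; (unfold a_inv_def[symmetric])?)
      show "?J \<subseteq> carrier (add_monoid (consta_ring n a))"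
        by (auto simp: consta_ring_carrier)
      show "x \<otimes>\<^bsub>add_monoid (consta_ring n a)\<^esub> y \<in> ?J" if "x \<in> ?J" "y \<in> ?J" for x y
      proof -
        from that obtain A B A' B' where "x = consta_class n a (A * g + B * h)"
          "y = consta_class n a (A' * g + B' * h)" by auto
        then have "x \<otimes>\<^bsub>add_monoid (consta_ring n a)\<^esub> y
            = consta_class n a ((A + A') * g + (B + B') * h)"
          by (simp add: consta_class_add algebra_simps)
        then show ?thesis by blast
      qed
      have "consta_class n a 0 = consta_class n a (0 * g + 0 * h)" by simp
      then show "\<one>\<^bsub>add_monoid (consta_ring n a)\<^esub> \<in> ?J"
        unfolding monoid.simps consta_class_zero by blast
      show "\<ominus>\<^bsub>consta_ring n a\<^esub> x \<in> ?J" if "x \<in> ?J" for x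
      proof -
        from that obtain A B where x: "x = consta_class n a (A * g + B * h)" by auto
        have "consta_class n a (- A * g + - B * h) \<oplus>\<^bsub>consta_ring n a\<^esub> x = \<zero>\<^bsub>consta_ring n a\<^esub>"
          by (simp add: x consta_class_add consta_class_zero)
        then have "\<ominus>\<^bsub>consta_ring n a\<^esub> x = consta_class n a (- A * g + - B * h)"
          by (intro Q.minus_equality) (auto simp: x consta_ring_carrier)
        then show ?thesis by blast
      qed
    qed
  next
    show "x \<otimes>\<^bsub>consta_ring n a\<^esub> b \<in> ?J" "b \<otimes>\<^bsub>consta_ring n a\<^esub> x \<in> ?J"
      if bx: "b \<in> ?J" "x \<in> carrier (consta_ring n a)" for b x
    proof -
      obtain A B f where b: "b = consta_class n a (A * g + B * h)" and x: "x = consta_class n a f"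
        using bx by (auto simp: consta_ring_carrier)
      have "x \<otimes>\<^bsub>consta_ring n a\<^esub> b = consta_class n a ((f * A) * g + (f * B) * h)"
        by (simp add: b x consta_class_mult algebra_simps)
      then show "x \<otimes>\<^bsub>consta_ring n a\<^esub> b \<in> ?J" by blast
      then show "b \<otimes>\<^bsub>consta_ring n a\<^esub> x \<in> ?J"
        using bx b by (subst Q.m_comm) (auto simp: consta_ring_carrier)
    qed
  qed (rule Q.ring_axioms)
  have "consta_class n a g = consta_class n a (1 * g + 0 * h)"
       "consta_class n a h = consta_class n a (0 * g + 1 * h)" by simp_all
  then have "consta_class n a ` {g, h} \<subseteq> ?J" by blast
  then have 1: "consta_ideal n a {g, h} \<subseteq> ?J"
    unfolding consta_ideal_def by (rule Q.genideal_minimal[OF J])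
  have gh: "consta_class n a g \<in> consta_ideal n a {g, h}" "consta_class n a h \<in> consta_ideal n a {g, h}"
    using Q.genideal_self[OF sub] unfolding consta_ideal_def by auto
  have 2: "consta_class n a (A * g + B * h) \<in> consta_ideal n a {g, h}" for A B
  proof -
    have "consta_class n a (A * g) \<in> consta_ideal n a {g, h}"
      "consta_class n a (B * h) \<in> consta_ideal n a {g, h}"
      using I.I_l_closed[OF gh(1), of "consta_class n a A"] I.I_l_closed[OF gh(2), of "consta_class n a B"]
      by (auto simp: consta_ring_carrier consta_class_mult)
    from I.a_closed[OF this] show ?thesis by (simp add: consta_class_add)
  qed
  show ?thesis using 1 2 by blast
qed

lemma consta_class_in_ideal_iff:
  "consta_class n a f \<in> consta_ideal n a {g, h} \<longleftrightarrow>
     (\<exists>A B. eqmod (consta_modulus n a) f (A * g + B * h))"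
  by (auto simp: consta_ideal_two_gens consta_class_eq_iff)

lemma consta_ideal_is_ideal: "ideal (consta_ideal n a S) (consta_ring n a)"
proof -
  interpret Q: cring "consta_ring n a" by (rule consta_ring_cring)
  show ?thesis unfolding consta_ideal_def
    by (rule Q.genideal_ideal) (auto simp: consta_ring_carrier)
qed

lemma consta_class_in_annihilator_iff:
  assumes "I \<subseteq> carrier (consta_ring n a)"
  shows "consta_class n a f \<in> annihilator (consta_ring n a) I \<longleftrightarrow>
     (\<forall>g. consta_class n a g \<in> I \<longrightarrow> consta_modulus n a dvd f * g)"
proof -
  have "consta_class n a f \<in> annihilator (consta_ring n a) I \<longleftrightarrow>
     (\<forall>c\<in>I. consta_class n a f \<otimes>\<^bsub>consta_ring n a\<^esub> c = consta_class n a 0)"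
    by (simp add: annihilator_def consta_ring_carrier consta_class_zero)
  also have "\<dots> \<longleftrightarrow> (\<forall>g. consta_class n a g \<in> I \<longrightarrow> consta_class n a (f * g) = consta_class n a 0)"
    using assms by (force simp: consta_ring_carrier consta_class_mult)
  finally show ?thesis by (simp add: consta_class_eq_iff eqmod_0_iff)
qed

text \<open>
  Annihilating an ideal amounts to annihilating its generators, which turns the condition into two
  divisibilities between polynomials.
\<close>

lemma consta_class_in_annihilator_two_gens:
  "consta_class n a f \<in> annihilator (consta_ring n a) (consta_ideal n a {g, h}) \<longleftrightarrow>
     consta_modulus n a dvd f * g \<and> consta_modulus n a dvd f * h"
proof -
  let ?m = "consta_modulus n a"
  have "consta_ideal n a {g, h} \<subseteq> carrier (consta_ring n a)"
    by (auto simp: consta_ideal_two_gens consta_ring_carrier)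
  note iff = consta_class_in_annihilator_iff[OF this, of f]
  show ?thesis
  proof
    assume "consta_class n a f \<in> annihilator (consta_ring n a) (consta_ideal n a {g, h})"
    then have *: "?m dvd f * k" if "consta_class n a k \<in> consta_ideal n a {g, h}" for k
      using that iff by blast
    have "eqmod ?m g (1 * g + 0 * h)" "eqmod ?m h (0 * g + 1 * h)" by simp_all
    then show "?m dvd f * g \<and> ?m dvd f * h"
      using * consta_class_in_ideal_iff by metis
  next
    assume d: "?m dvd f * g \<and> ?m dvd f * h"
    have "?m dvd f * k" if "eqmod ?m k (A * g + B * h)" for k A B
    proof -
      have "?m dvd A * (f * g) + B * (f * h)"
        using d by (intro dvd_add dvd_mult[of _ "f * g"] dvd_mult[of _ "f * h"]) auto
      then have "?m dvd f * (A * g + B * h)" by (simp add: algebra_simps)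
      then show ?thesis
        using eqmod_dvd[OF eqmod_mult[OF eqmod_refl[of ?m f] that]] by blast
    qed
    then show "consta_class n a f \<in> annihilator (consta_ring n a) (consta_ideal n a {g, h})"
      unfolding iff consta_class_in_ideal_iff by blast
  qed
qed

lemma unit_inv_right:
  fixes a :: "'r::comm_ring_1"
  assumes "a dvd 1"
  shows "a * unit_inv a = 1"
proof -
  interpret cring "ring_of_type_algebra :: 'r ring" by (rule cring_from_type_algebra)
  obtain b where "1 = a * b" using assms by (elim dvdE)
  then have "a \<in> Units (ring_of_type_algebra :: 'r ring)"
    unfolding Units_def by (auto simp: ring_of_type_algebra_def mult.commute intro!: exI[of _ b])
  from Units_r_inv[OF this] show ?thesis
    unfolding unit_inv_def by (simp add: ring_of_type_algebra_def)
qed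

text \<open>
  Adding the modulus to a reduced representative produces a representative of degree exactly \<open>n\<close>.
\<close>

lemma consta_modulus_add_degree:
  fixes r :: "'r::comm_ring_1 poly"
  assumes "0 < n" "Polynomial.degree r < n"
  shows "Polynomial.degree (r + consta_modulus n a) = n"
proof -
  have "Polynomial.degree (r - [:a:]) < n"
    using assms degree_diff_le_max[of r "[:a:]"] by simp
  then have "Polynomial.degree (Polynomial.monom 1 n + (r - [:a:])) = n"
    by (subst degree_add_eq_left) (simp_all add: degree_monom_eq)
  then show ?thesis by (simp add: consta_modulus_def algebra_simps)
qed

lemma consta_modulus_not_dvd:
  fixes r :: "'r::comm_ring_1 poly"
  assumes "Polynomial.degree r < n" "consta_modulus n a dvd r"
  shows "r = 0"
proof (rule ccontr)
  assume r: "r \<noteq> 0"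
  obtain h where h: "r = consta_modulus n a * h" using assms(2) by (elim dvdE)
  have d: "Polynomial.degree (consta_modulus n a) = n"
    using consta_modulus_add_degree[of n 0 a] assms(1) by simp
  have "Polynomial.coeff (consta_modulus n a) n = 1"
    using assms(1) by (simp add: consta_modulus_def coeff_pCons split: nat.splits)
  then have "Polynomial.coeff r (n + Polynomial.degree h) = lead_coeff h"
    using coeff_mult_degree_sum[of "consta_modulus n a" h] by (simp add: h d)
  moreover have "Polynomial.coeff r (n + Polynomial.degree h) = 0"
    using assms(1) by (intro coeff_eq_0) simp
  ultimately show False using h r by simp
qed

text \<open>
  The modulus is monic, so division with remainder works over any commutative ring.
\<close>

lemma consta_reduce:
  fixes f :: "'r::comm_ring_1 poly"
  assumes "0 < n"
  shows "\<exists>r. Polynomial.degree r < n \<and> eqmod (consta_modulus n a) f r"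
proof -
  have d: "Polynomial.degree (consta_modulus n a) = n"
    using consta_modulus_add_degree[of n 0 a] assms by simp
  have "Polynomial.coeff (consta_modulus n a) n = 1"
    using assms by (simp add: consta_modulus_def coeff_pCons split: nat.splits)
  moreover from this have "consta_modulus n a \<noteq> 0" by auto
  moreover obtain g r where gr: "pseudo_divmod f (consta_modulus n a) = (g, r)" by force
  ultimately have "f = consta_modulus n a * g + r" "r = 0 \<or> Polynomial.degree r < n"
    using pseudo_divmod[of "consta_modulus n a" f g r] d by auto
  then show ?thesis using assms by (intro exI[of _ r]) (auto simp: eqmod_def)
qed


section \<open>The substitution of the inverse of x\<close>

text \<open>
  When \<open>b\<close> is the inverse of \<open>a\<close>, \<open>b x\<^bsup>n-1\<^esup>\<close> is the inverse of \<open>x\<close> modulo \<open>x\<^sup>n - a\<close>, so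
  \<open>invert_x n b f\<close> represents \<open>f(x\<^sup>-\<^sup>1)\<close> there.
\<close>

definition invert_x :: "nat \<Rightarrow> 'r::comm_ring_1 \<Rightarrow> 'r poly \<Rightarrow> 'r poly" where
  "invert_x n b f = pcompose f (Polynomial.monom b (n - 1))"

lemma eqmod_x_power:
  "eqmod (consta_modulus n a) (Polynomial.monom 1 1 ^ n) [:a:]"
  by (simp add: eqmod_def consta_modulus_def monom_power)

lemma x_inverse:
  assumes "a * b = 1" "0 < n"
  shows "eqmod (consta_modulus n a) (Polynomial.monom 1 1 * Polynomial.monom b (n - 1)) 1"
proof -
  have "Polynomial.monom 1 1 * Polynomial.monom b (n - 1) - 1 = [:b:] * consta_modulus n a"
    using assms by (simp add: consta_modulus_def mult_monom smult_monom algebra_simps one_pCons)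
  then show ?thesis unfolding eqmod_def by (metis dvd_triv_right)
qed

lemma eqmod_pcompose:
  "eqmod m y y' \<Longrightarrow> eqmod m (pcompose f y) (pcompose f y')"
  by (induction f) (auto simp: pcompose_pCons intro!: eqmod_add eqmod_mult)

lemma invert_x_mult: "invert_x n b (f * g) = invert_x n b f * invert_x n b g"
  by (simp add: invert_x_def pcompose_mult)

lemma invert_x_add: "invert_x n b (f + g) = invert_x n b f + invert_x n b g"
  by (simp add: invert_x_def pcompose_add)

lemma invert_x_diff: "invert_x n b (f - g) = invert_x n b f - invert_x n b g"
  by (simp add: invert_x_def pcompose_diff)

lemma invert_x_const: "invert_x n b [:c:] = [:c:]"
  by (simp add: invert_x_def)

lemma invert_x_1: "invert_x n b 1 = 1"
  by (simp add: invert_x_def pcompose_1)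

lemma invert_x_power: "invert_x n b (f ^ k) = invert_x n b f ^ k"
  by (induction k) (simp_all add: invert_x_1 invert_x_mult)

lemma invert_x_sum: "invert_x n b (sum f A) = (\<Sum>i\<in>A. invert_x n b (f i))"
  by (simp add: invert_x_def pcompose_sum)

lemma invert_x_x: "invert_x n b (Polynomial.monom 1 1) = Polynomial.monom b (n - 1)"
  by (simp add: invert_x_def monom_altdef pcompose_pCons)

text \<open>
  With \<open>y = a x\<^bsup>n-1\<^esup> = x\<^sup>-\<^sup>1\<close> modulo \<open>x\<^sup>n - b\<close> one has \<open>y\<^sup>n = b\<^sup>-\<^sup>1 = a\<close>, so substituting \<open>y\<close> sends
  \<open>x\<^sup>n - a\<close> to zero and induces a map of quotient rings.
\<close>

lemma eqmod_invert_x: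
  assumes "a * b = 1" "0 < n" "eqmod (consta_modulus n a) f g"
  shows "eqmod (consta_modulus n b) (invert_x n a f) (invert_x n a g)"
proof -
  let ?x = "Polynomial.monom 1 1 :: 'a poly" and ?y = "Polynomial.monom a (n - 1)"
  let ?m = "consta_modulus n b"
  have xy: "eqmod ?m (?x * ?y) 1" using x_inverse[of b a n] assms by (simp add: mult.commute)
  have "eqmod ?m (?x ^ n * ?y ^ n) 1"
    using eqmod_power[OF xy, of n] by (simp add: power_mult_distrib)
  then have "eqmod ?m ([:b:] * ?y ^ n) 1"
    using eqmod_mult[OF eqmod_sym[OF eqmod_x_power] eqmod_refl] eqmod_trans by blast
  from eqmod_mult[OF eqmod_refl[of _ "[:a:]"] this]
  have "eqmod ?m (([:a:] * [:b:]) * ?y ^ n) [:a:]"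
    by (metis mult.assoc mult.right_neutral)
  then have "eqmod ?m (?y ^ n) [:a:]" using assms by (simp add: mult.commute[of b a])
  moreover have "invert_x n a (consta_modulus n a) = ?y ^ n - [:a:]"
  proof -
    have "consta_modulus n a = ?x ^ n - [:a:]" by (simp add: consta_modulus_def monom_power)
    then show ?thesis by (simp only: invert_x_diff invert_x_power invert_x_x invert_x_const)
  qed
  ultimately have "?m dvd invert_x n a (consta_modulus n a)" by (simp add: eqmod_def)
  moreover obtain h where "f - g = consta_modulus n a * h" using assms(3) by (auto simp: eqmod_def)
  ultimately have "?m dvd invert_x n a (f - g)" by (simp add: invert_x_mult)
  then show ?thesis by (simp add: eqmod_def invert_x_diff)
qed

text \<open>
  The two substitutions are mutually inverse: the second sends \<open>x\<^sup>-\<^sup>1\<close> to the inverse of \<open>x\<^sup>-\<^sup>1\<close>, because it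
  preserves the equation \<open>x x\<^sup>-\<^sup>1 = 1\<close>.
\<close>

lemma invert_x_invert_x:
  assumes "a * b = 1" "0 < n"
  shows "eqmod (consta_modulus n a) (invert_x n b (invert_x n a f)) f"
proof -
  let ?x = "Polynomial.monom 1 1 :: 'a poly"
  let ?y = "Polynomial.monom a (n - 1)" and ?y' = "Polynomial.monom b (n - 1)"
  let ?m = "consta_modulus n a"
  have "eqmod (consta_modulus n b) (?x * ?y) 1"
    using x_inverse[of b a n] assms by (simp add: mult.commute)
  from eqmod_invert_x[OF _ assms(2) this, of a] assms
  have yy: "eqmod ?m (?y' * invert_x n b ?y) 1"
    by (simp add: mult.commute invert_x_mult invert_x_x[simplified] invert_x_1)
  have "eqmod ?m ((?x * ?y') * invert_x n b ?y) (1 * invert_x n b ?y)"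
    by (rule eqmod_mult[OF x_inverse[OF assms] eqmod_refl])
  then have "eqmod ?m (invert_x n b ?y) ((?x * ?y') * invert_x n b ?y)"
    by (metis eqmod_sym mult_1)
  also have "eqmod ?m ((?x * ?y') * invert_x n b ?y) ?x"
    using eqmod_mult[OF eqmod_refl yy, of ?x] by (simp add: mult.assoc)
  finally have "eqmod ?m (pcompose f (invert_x n b ?y)) (pcompose f ?x)" by (rule eqmod_pcompose)
  then show ?thesis by (simp add: invert_x_def pcompose_assoc monom_altdef)
qed

lemma reflect_poly_eqmod:
  assumes "eqmod m (Polynomial.monom 1 1 * y) 1"
  shows "eqmod m (reflect_poly f) (Polynomial.monom 1 1 ^ Polynomial.degree f * pcompose f y)"
proof (induction f)
  case (pCons c f)
  let ?x = "Polynomial.monom 1 1 :: 'a poly"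
  show ?case
  proof (cases "f = 0")
    case True
    then show ?thesis by (simp add: reflect_poly_const)
  next
    case False
    let ?d = "Polynomial.degree f"
    have "eqmod m (reflect_poly f + ?x ^ Suc ?d * [:c:])
        (?x ^ ?d * pcompose f y * 1 + ?x ^ Suc ?d * [:c:])"
      using pCons.IH by (intro eqmod_add) simp_all
    also have "eqmod m (?x ^ ?d * pcompose f y * 1 + ?x ^ Suc ?d * [:c:])
        (?x ^ ?d * pcompose f y * (?x * y) + ?x ^ Suc ?d * [:c:])"
      by (intro eqmod_add eqmod_mult eqmod_refl eqmod_sym[OF assms])
    also have "?x ^ ?d * pcompose f y * (?x * y) + ?x ^ Suc ?d * [:c:]
        = ?x ^ Suc ?d * pcompose (pCons c f) y"
      by (simp only: pcompose_pCons power_Suc ring_distribs mult_ac add_ac)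
    also have "reflect_poly f + ?x ^ Suc ?d * [:c:] = reflect_poly (pCons c f)"
      using False by (simp add: reflect_poly_pCons' monom_power smult_monom del: power_Suc)
    finally show ?thesis using False by simp
  qed
qed simp


section \<open>Reciprocals of an annihilator\<close>

text \<open>
  Reciprocals differ from images under \<open>x \<mapsto> x\<^sup>-\<^sup>1\<close> by a power of \<open>x\<close> depending on the degree of the
  representative.  An annihilator is closed under multiplication by the unit \<open>x\<close>, and adding the
  modulus gives a representative of any class whose degree is known to be \<open>n\<close>, so the power of \<open>x\<close>
  can be compensated.
\<close>

lemma consta_class_in_star_iff:
  fixes a :: "'r::comm_ring_1"
  assumes ab: "a * b = 1" and b: "b = unit_inv a" and n: "0 < n"
    and I: "I \<subseteq> carrier (consta_ring n a)"
  shows "consta_class n b g \<in> annihilator_star n a I \<longleftrightarrow>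
    consta_class n a (invert_x n b g) \<in> annihilator (consta_ring n a) I"
proof -
  let ?x = "Polynomial.monom 1 1 :: 'r poly"
  let ?y = "Polynomial.monom a (n - 1)" and ?y' = "Polynomial.monom b (n - 1)"
  let ?a = "consta_modulus n a" and ?b = "consta_modulus n b"
  have ba: "b * a = 1" using ab by (simp add: mult.commute)
  have ann_mult: "consta_class n a f' \<in> annihilator (consta_ring n a) I"
    if "consta_class n a f \<in> annihilator (consta_ring n a) I" "eqmod ?a f' (h * f)" for f f' h
  proof -
    have "?a dvd f' * g" if "?a dvd f * g" for g
      using dvd_mult[OF that, of h] eqmod_dvd[OF eqmod_mult[OF \<open>eqmod ?a f' (h * f)\<close> eqmod_refl[of _ g]]]
      by (simp add: mult.assoc)
    then show ?thesis using that(1) unfolding consta_class_in_annihilator_iff[OF I] by blast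
  qed
  show ?thesis
  proof
    assume "consta_class n b g \<in> annihilator_star n a I"
    then obtain f where f: "eqmod ?b g (reflect_poly f)"
      "consta_class n a f \<in> annihilator (consta_ring n a) I"
      unfolding annihilator_star_def b[symmetric] by (auto simp: consta_class_eq_iff)
    let ?d = "Polynomial.degree f"
    have "eqmod ?b g (?x ^ ?d * invert_x n a f)"
      using eqmod_trans[OF f(1) reflect_poly_eqmod[OF x_inverse[OF ba n]]] by (simp add: invert_x_def)
    from eqmod_invert_x[OF ba n this]
    have "eqmod ?a (invert_x n b g) (?y' ^ ?d * invert_x n b (invert_x n a f))"
      by (simp only: invert_x_mult invert_x_power invert_x_x)
    also have "eqmod ?a \<dots> (?y' ^ ?d * f)"
      by (intro eqmod_mult eqmod_refl invert_x_invert_x ab n)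
    finally show "consta_class n a (invert_x n b g) \<in> annihilator (consta_ring n a) I"
      using ann_mult[OF f(2)] by blast
  next
    assume *: "consta_class n a (invert_x n b g) \<in> annihilator (consta_ring n a) I"
    \<comment> \<open>The factor \<open>x\<^sup>n\<close> makes up for the degree \<open>n\<close> of the representative \<open>f\<close> chosen below.\<close>
    obtain r where r: "Polynomial.degree r < n" "eqmod ?a (?x ^ n * invert_x n b g) r"
      using consta_reduce[OF n] by blast
    define f where "f = r + ?a"
    have deg: "Polynomial.degree f = n" unfolding f_def by (rule consta_modulus_add_degree[OF n r(1)])
    have "eqmod ?a r f" by (simp add: f_def eqmod_def)
    with r have rf: "eqmod ?a f (?x ^ n * invert_x n b g)" using eqmod_trans eqmod_sym by blast
    then have fA: "consta_class n a f \<in> annihilator (consta_ring n a) I" using ann_mult[OF *] by blast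
    have "eqmod ?b (reflect_poly f) (?x ^ n * invert_x n a f)"
      using reflect_poly_eqmod[OF x_inverse[OF ba n], of f] by (simp add: invert_x_def deg)
    also have "eqmod ?b \<dots> (?x ^ n * invert_x n a (?x ^ n * invert_x n b g))"
      by (intro eqmod_mult eqmod_refl eqmod_invert_x[OF ab n rf])
    also have "?x ^ n * invert_x n a (?x ^ n * invert_x n b g)
        = (?x * ?y) ^ n * invert_x n a (invert_x n b g)"
      by (simp only: invert_x_mult invert_x_power invert_x_x power_mult_distrib mult_ac)
    also have "eqmod ?b \<dots> (1 ^ n * g)"
      by (intro eqmod_mult eqmod_power x_inverse invert_x_invert_x ba n)
    finally have "eqmod ?b g (reflect_poly f)" by (simp add: eqmod_sym)
    with fA show "consta_class n b g \<in> annihilator_star n a I"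
      unfolding annihilator_star_def b[symmetric] by (auto simp: consta_class_eq_iff)
  qed
qed


section \<open>The dual of a constacyclic code\<close>

text \<open>
  The constant term of the reduced representative of \<open>f\<close> modulo \<open>x\<^sup>n - a\<close>: a power \<open>x\<^sup>i\<close> contributes
  to it only when \<open>i = n k\<close>, and \<open>x\<^bsup>nk\<^esup>\<close> reduces to \<open>a\<^sup>k\<close>.
\<close>

definition const_part :: "nat \<Rightarrow> 'r::comm_ring_1 \<Rightarrow> 'r poly \<Rightarrow> 'r" where
  "const_part n a f =
     (\<Sum>i\<le>Polynomial.degree f. Polynomial.coeff f i * (if n dvd i then a ^ (i div n) else 0))"

lemma const_part_sum_le:
  "Polynomial.degree f \<le> N \<Longrightarrow>
    const_part n a f = (\<Sum>i\<le>N. Polynomial.coeff f i * (if n dvd i then a ^ (i div n) else 0))"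
  unfolding const_part_def by (intro sum.mono_neutral_left) (auto simp: coeff_eq_0)

lemma const_part_add: "const_part n a (f + g) = const_part n a f + const_part n a g"
proof -
  define N where "N = max (Polynomial.degree f) (Polynomial.degree g)"
  have "Polynomial.degree (f + g) \<le> N" "Polynomial.degree f \<le> N" "Polynomial.degree g \<le> N"
    unfolding N_def by (auto intro: degree_add_le)
  then show ?thesis
    by (simp add: const_part_sum_le sum.distrib[symmetric] distrib_right)
qed

lemma const_part_0 [simp]: "const_part n a 0 = 0"
  by (simp add: const_part_def)

lemma const_part_sum: "const_part n a (sum f A) = (\<Sum>i\<in>A. const_part n a (f i))"
  by (induction A rule: infinite_finite_induct) (simp_all add: const_part_add)

lemma const_part_monom:
  "const_part n a (Polynomial.monom c i) = (if n dvd i then c * a ^ (i div n) else 0)"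
proof -
  have "const_part n a (Polynomial.monom c i) =
      (\<Sum>j\<le>i. if j = i then (if n dvd i then c * a ^ (i div n) else 0) else 0)"
    by (subst const_part_sum_le[OF degree_monom_le]) (intro sum.cong; auto)
  then show ?thesis by simp
qed

lemma const_part_modulus:
  fixes a :: "'r::comm_ring_1"
  assumes "0 < n" "consta_modulus n a dvd f"
  shows "const_part n a f = 0"
proof -
  obtain h where f: "f = consta_modulus n a * h" using assms(2) by (elim dvdE)
  have h: "h = (\<Sum>i\<le>Polynomial.degree h. Polynomial.monom (Polynomial.coeff h i) i)"
    by (simp add: poly_as_sum_of_monoms)
  have m: "const_part n a (Polynomial.monom c i * consta_modulus n a) = 0" for c i
  proof -
    have "Polynomial.monom c i * consta_modulus n a
        = Polynomial.monom c (i + n) + Polynomial.monom (- (c * a)) i"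
      by (simp add: consta_modulus_def algebra_simps mult_monom smult_monom add_monom minus_monom)
    then show ?thesis using assms(1) by (simp add: const_part_add const_part_monom mult.assoc)
  qed
  have "f = (\<Sum>i\<le>Polynomial.degree h. Polynomial.monom (Polynomial.coeff h i) i * consta_modulus n a)"
    unfolding f by (subst h) (simp only: sum_distrib_left mult.commute)
  then show ?thesis by (simp add: const_part_sum m)
qed

lemma const_part_eqmod:
  assumes "0 < n" "eqmod (consta_modulus n a) f g"
  shows "const_part n a f = const_part n a g"
  using const_part_modulus[OF assms(1), of a "f - g"] assms(2) const_part_add[of n a "f - g" g]
  by (simp add: eqmod_def)

text \<open>
  In \<open>f(x) g(x\<^sup>-\<^sup>1)\<close> the monomial \<open>x\<^sup>i x\<^bsup>-j\<^esup>\<close> has exponent strictly between \<open>-n\<close> and \<open>n\<close>, so only the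
  diagonal \<open>i = j\<close> reaches the constant term.
\<close>

lemma const_part_inner_product:
  fixes a :: "'r::comm_ring_1"
  assumes ab: "a * b = 1" and f: "Polynomial.degree f < n" and g: "Polynomial.degree g < n"
  shows "const_part n a (f * invert_x n b g)
    = (\<Sum>i<n. Polynomial.coeff f i * Polynomial.coeff g i)"
proof -
  have sum_monoms: "h = (\<Sum>i<n. Polynomial.monom (Polynomial.coeff h i) i)"
    if "Polynomial.degree h < n" for h :: "'r poly"
    using that by (intro poly_eqI) (auto simp: coeff_sum coeff_eq_0)
  have g': "invert_x n b g
      = (\<Sum>j<n. Polynomial.monom (Polynomial.coeff g j * b ^ j) ((n - 1) * j))"
  proof -
    have "invert_x n b (Polynomial.monom c j) = Polynomial.monom (c * b ^ j) ((n - 1) * j)" for c j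
    proof -
      have "Polynomial.monom c j = [:c:] * Polynomial.monom 1 1 ^ j"
        by (simp add: monom_power smult_monom)
      then show ?thesis
        by (simp only: invert_x_mult invert_x_const invert_x_power invert_x_x)
          (simp add: monom_power smult_monom)
    qed
    then show ?thesis by (subst sum_monoms[OF g]) (simp add: invert_x_sum)
  qed
  have dvd_iff: "n dvd i + (n - 1) * j \<longleftrightarrow> i = j" if "i < n" "j < n" for i j
  proof -
    have "i + (n - 1) * j + j = i + n * j" using that by (cases n) simp_all
    then have "int (i + (n - 1) * j) = int i - int j + int n * int j"
      by (simp only: of_nat_add[symmetric] of_nat_mult[symmetric] eq_diff_eq diff_add_eq)
    then have "n dvd i + (n - 1) * j \<longleftrightarrow> int n dvd int i - int j"
      by (metis int_dvd_int_iff dvd_add_left_iff dvd_triv_left)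
    also have "\<dots> \<longleftrightarrow> i = j"
      using that by (simp flip: mod_eq_dvd_iff)
    finally show ?thesis .
  qed
  have summand: "const_part n a (Polynomial.monom (c * (d * b ^ j)) (i + (n - 1) * j))
      = (if i = j then c * d else 0)" if "i < n" "j < n" for c d i j
  proof -
    have 1: "j + (n - 1) * j = n * j"
      using that by (cases n) simp_all
    have 2: "b ^ j * a ^ j = 1" using ab by (metis mult.commute power_mult_distrib power_one)
    show ?thesis
      using that 1 2 by (auto simp: const_part_monom dvd_iff[unfolded One_nat_def] mult.assoc)
  qed
  have "f * invert_x n b g = (\<Sum>i<n. \<Sum>j<n. Polynomial.monom
      (Polynomial.coeff f i * (Polynomial.coeff g j * b ^ j)) (i + (n - 1) * j))"
    unfolding g' by (subst sum_monoms[OF f]) (simp add: sum_product mult_monom)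
  then have "const_part n a (f * invert_x n b g)
      = (\<Sum>i<n. \<Sum>j<n. if i = j then Polynomial.coeff f i * Polynomial.coeff g j else 0)"
    by (simp add: const_part_sum summand[unfolded One_nat_def])
  then show ?thesis by simp
qed

text \<open>
  A word \<open>d\<close> is orthogonal to the code when \<open>c(x) d(x\<^sup>-\<^sup>1)\<close> has constant term zero for all codewords
  \<open>c\<close>.  The code is closed under multiplication by powers of \<open>x\<^sup>-\<^sup>1\<close>, and these move every
  coefficient of the product into the constant position; hence the whole product vanishes.
\<close>

lemma dual_code_eq_annihilator_star:
  fixes a :: "'r::comm_ring_1"
  assumes ab: "a * b = 1" and b: "b = unit_inv a" and n: "0 < n"
    and I: "ideal I (consta_ring n a)"
  shows "dual_code n (consta_code n a I) = consta_code n b (annihilator_star n a I)"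
proof -
  let ?m = "consta_modulus n a" and ?Q = "consta_ring n a"
  interpret I: ideal I ?Q by (rule I)
  have Isub: "I \<subseteq> carrier ?Q" using I.a_subset .
  have list_deg: "Polynomial.degree (Poly c) < n" if "length c = n" for c :: "'r list"
    by (rule le_less_trans[OF degree_le[of "n - 1"]]) (use n that in \<open>auto simp: nth_default_def\<close>)
  have inner: "(\<Sum>i<n. c ! i * d ! i) = const_part n a (Poly c * invert_x n b (Poly d))"
    if "length c = n" "length d = n" for c d
    using that by (simp add: const_part_inner_product[OF ab] list_deg nth_default_nth)
  have "d \<in> dual_code n (consta_code n a I) \<longleftrightarrow> d \<in> consta_code n b (annihilator_star n a I)"
    if d: "length d = n" for d
  proof -
    let ?d = "invert_x n b (Poly d)"
    have rhs: "d \<in> consta_code n b (annihilator_star n a I) \<longleftrightarrow>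
        (\<forall>f. consta_class n a f \<in> I \<longrightarrow> ?m dvd ?d * f)"
      using d by (simp add: consta_code_def consta_class_in_star_iff[OF ab b n Isub]
          consta_class_in_annihilator_iff[OF Isub])
    show ?thesis
    proof
      assume "d \<in> consta_code n b (annihilator_star n a I)"
      then have "(\<Sum>i<n. c ! i * d ! i) = 0" if "c \<in> consta_code n a I" for c
        using that d inner[of c d] const_part_modulus[OF n, of a "Poly c * ?d"] unfolding rhs
        by (auto simp: consta_code_def mult.commute)
      then show "d \<in> dual_code n (consta_code n a I)" using d by (simp add: dual_code_def)
    next
      assume dual: "d \<in> dual_code n (consta_code n a I)"
      have "?m dvd ?d * f" if f: "consta_class n a f \<in> I" for f
      proof -
        obtain e where e: "Polynomial.degree e < n" "eqmod ?m (?d * f) e"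
          using consta_reduce[OF n] by blast
        \<comment> \<open>The coefficient of \<open>x\<^sup>k\<close> in \<open>e\<close> is the constant term of \<open>e x\<^bsup>-k\<^esup>\<close>, which is the inner product of
          \<open>d\<close> with the codeword \<open>c\<close> representing \<open>f x\<^bsup>-k\<^esup>\<close>.\<close>
        have "Polynomial.coeff e k = 0" if k: "k < n" for k
        proof -
          let ?g = "invert_x n b (Polynomial.monom 1 k)"
          obtain c where c: "Polynomial.degree c < n" "eqmod ?m (?g * f) c"
            using consta_reduce[OF n] by blast
          have "consta_class n a c \<in> I"
            using I.I_l_closed[OF f, of "consta_class n a ?g"] c(2) eqmod_sym
            by (auto simp: consta_ring_carrier consta_class_mult consta_class_eq_iff[symmetric])
          moreover define cs where "cs = map (Polynomial.coeff c) [0..<n]"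
          have cs: "Poly cs = c"
            using c(1) by (intro poly_eqI) (auto simp: cs_def nth_default_def coeff_eq_0)
          ultimately have "cs \<in> consta_code n a I" by (simp add: consta_code_def cs_def)
          then have "(\<Sum>i<n. cs ! i * d ! i) = 0" using dual by (auto simp: dual_code_def)
          then have "const_part n a (c * ?d) = 0"
            using inner[of cs d] d cs by (simp add: cs_def)
          have "Polynomial.coeff e k = const_part n a (e * ?g)"
            using k by (subst const_part_inner_product[OF ab e(1)])
              (auto simp: degree_monom_eq if_distrib[of "(*) _"] cong: if_cong)
          also have "\<dots> = const_part n a (?d * f * ?g)"
            by (rule const_part_eqmod[OF n eqmod_mult[OF eqmod_sym[OF e(2)] eqmod_refl]])
          also have "?d * f * ?g = (?g * f) * ?d" by (simp add: mult_ac)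
          also have "const_part n a \<dots> = const_part n a (c * ?d)"
            by (rule const_part_eqmod[OF n eqmod_mult[OF c(2) eqmod_refl]])
          also have "\<dots> = 0" by fact
          finally show ?thesis .
        qed
        then have "e = 0" using e(1) by (intro poly_eqI) (metis coeff_0 coeff_eq_0 le_less_trans not_less)
        then show ?thesis using e(2) by (simp add: eqmod_0_iff)
      qed
      then show "d \<in> consta_code n b (annihilator_star n a I)" unfolding rhs by blast
    qed
  qed
  then show ?thesis unfolding dual_code_def consta_code_def by blast
qed


section \<open>Polynomials over the ring with u and v\<close>

lemma uv_const_ops:
  "uv_const a + uv_const b = uv_const (a + b)"
  "uv_const a - uv_const b = uv_const (a - b)"
  "uv_const a * uv_const b = uv_const (a * b)"
  "uv_const 1 = 1" "uv_const 0 = 0"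
  by (simp_all add: uv_const_def one_uvring_def zero_uvring_def minus_uvring_def)

lemma cP_diff: "cP (a - b) = cP a - cP b"
  and cP_mult: "cP (a * b) = cP a * cP b"
  and cP_1: "cP 1 = 1"
  and cP_0: "cP 0 = 0"
  by (simp_all add: cP_def uv_const_ops one_pCons mult.commute)

lemma cP_power: "cP (a ^ k) = cP a ^ k"
  by (induction k) (simp_all add: cP_1 cP_mult)

definition vP :: "'a::comm_ring_1 uvring poly" where
  "vP = [:vv:]"

lemma uP_vP_nilpotent:
  "uP * uP = 0" "uP * (uP * f) = 0" "vP * vP = 0" "vP * (vP * f) = 0"
  by (simp_all add: uP_def vP_def uu_def vv_def zero_uvring_def[symmetric])

definition base_poly :: "'a::comm_ring_1 poly \<Rightarrow> 'a uvring poly" where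
  "base_poly = map_poly uv_const"

lemma coeff_base_poly: "Polynomial.coeff (base_poly f) i = uv_const (Polynomial.coeff f i)"
  by (simp add: base_poly_def coeff_map_poly uv_const_ops)

lemma uv_const_sum: "uv_const (sum f A) = (\<Sum>i\<in>A. uv_const (f i))"
  by (induction A rule: infinite_finite_induct) (simp_all add: uv_const_ops(1)[symmetric] uv_const_ops(5))

lemma base_poly_add: "base_poly (f + g) = base_poly f + base_poly g"
  and base_poly_diff: "base_poly (f - g) = base_poly f - base_poly g"
  and base_poly_mult: "base_poly (f * g) = base_poly f * base_poly g"
  and base_poly_1: "base_poly 1 = 1"
  and base_poly_const: "base_poly [:c:] = cP c"
  and base_poly_x: "base_poly (Polynomial.monom 1 1) = xP"
  by (intro poly_eqI; simp add: coeff_base_poly uv_const_ops coeff_mult uv_const_sum cP_def xP_def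
      coeff_pCons coeff_1 split: nat.splits)+

lemma base_poly_power: "base_poly (f ^ k) = base_poly f ^ k"
  by (induction k) (simp_all add: base_poly_1 base_poly_mult)

lemma uv_decompose:
  "\<exists>f0 f1 f2 f3. P = base_poly f0 + uP * base_poly f1 + vP * base_poly f2 + uP * vP * base_poly f3"
proof (intro exI poly_eqI)
  have z: "uv_1 0 = 0" "uv_u 0 = 0" "uv_v 0 = 0" "uv_uv 0 = 0"
    by (simp_all add: zero_uvring_def)
  show "Polynomial.coeff P i = Polynomial.coeff (base_poly (map_poly uv_1 P)
      + uP * base_poly (map_poly uv_u P) + vP * base_poly (map_poly uv_v P)
      + uP * vP * base_poly (map_poly uv_uv P)) i" for i
    by (cases "Polynomial.coeff P i")
      (simp add: coeff_base_poly coeff_map_poly z uP_def vP_def uv_const_def uu_def vv_def)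
qed

lemma uv_decomposition_zero:
  assumes "base_poly f0 + uP * base_poly f1 + vP * base_poly f2 + uP * vP * base_poly f3 = 0"
  shows "f0 = 0" "f1 = 0" "f2 = 0" "f3 = 0"
proof -
  have "UV (Polynomial.coeff f0 i) (Polynomial.coeff f1 i) (Polynomial.coeff f2 i) (Polynomial.coeff f3 i)
      = UV 0 0 0 0" for i
  proof -
    have "Polynomial.coeff (base_poly f0 + uP * base_poly f1 + vP * base_poly f2
        + uP * vP * base_poly f3) i = UV (Polynomial.coeff f0 i) (Polynomial.coeff f1 i)
          (Polynomial.coeff f2 i) (Polynomial.coeff f3 i)"
      by (simp add: coeff_base_poly uP_def vP_def uv_const_def uu_def vv_def)
    then show ?thesis by (simp add: assms zero_uvring_def)
  qed
  then show "f0 = 0" "f1 = 0" "f2 = 0" "f3 = 0" by (auto intro!: poly_eqI)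
qed

lemma x_cube_minus: "xP ^ 3 - cP a = base_poly (Polynomial.monom 1 1 ^ 3 - [:a:])"
  by (simp only: base_poly_diff base_poly_power base_poly_x base_poly_const)


section \<open>The quotient as an extension of F[x] by u\<close>

text \<open>
  The setting is a modulus \<open>x\<^sup>n - \<alpha>\<close> in which the coefficient of \<open>v\<close> is invertible; then \<open>v\<close> is
  redundant in the quotient.  \<open>W0\<close> is the image of the modulus under \<open>u, v \<mapsto> 0\<close>.
\<close>

locale uv_modulus =
  fixes n :: nat and \<alpha>1 \<alpha>2 \<alpha>3 \<alpha>4 :: "'a::field" and \<alpha> :: "'a uvring"
  assumes alpha: "\<alpha> = uv_const \<alpha>1 + uv_const \<alpha>2 * uu + uv_const \<alpha>3 * vv + uv_const \<alpha>4 * uu * vv"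
    and alpha3: "\<alpha>3 \<noteq> 0" and n_pos: "0 < n"
begin

abbreviation M :: "'a uvring poly" where
  "M \<equiv> consta_modulus n \<alpha>"

definition W0 :: "'a poly" where
  "W0 = Polynomial.monom 1 1 ^ n - [:\<alpha>1:]"

lemma modulus_split:
  "M = base_poly W0 - (cP \<alpha>2 * uP + cP \<alpha>3 * vP + cP \<alpha>4 * uP * vP)"
proof -
  have "M = xP ^ n - [:\<alpha>:]"
    by (simp add: consta_modulus_def xP_def monom_power)
  moreover have "[:\<alpha>:] = cP \<alpha>1 + (cP \<alpha>2 * uP + cP \<alpha>3 * vP + cP \<alpha>4 * uP * vP)"
    by (simp add: alpha cP_def uP_def vP_def add.assoc mult.assoc)
  ultimately show ?thesis
    unfolding W0_def by (simp only: base_poly_diff base_poly_power base_poly_x base_poly_const diff_diff_add)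
qed

lemma W0_eqmod: "eqmod M (base_poly W0) (cP \<alpha>2 * uP + cP \<alpha>3 * vP + cP \<alpha>4 * uP * vP)"
  by (simp add: eqmod_def modulus_split)

text \<open>
  All further relations come from \<open>W0 = \<alpha>\<^sub>2 u + \<alpha>\<^sub>3 v + \<alpha>\<^sub>4 uv\<close> by using that \<open>u\<close> and \<open>v\<close> square to zero.
\<close>

lemma u_W0_eqmod: "eqmod M (uP * base_poly W0) (cP \<alpha>3 * uP * vP)"
proof -
  have "eqmod M (uP * base_poly W0) (uP * (cP \<alpha>2 * uP + cP \<alpha>3 * vP + cP \<alpha>4 * uP * vP))"
    by (rule eqmod_mult[OF eqmod_refl W0_eqmod])
  then show ?thesis by (simp add: algebra_simps uP_vP_nilpotent)
qed

lemma u_W0_sq: "M dvd uP * base_poly W0 ^ 2"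
proof -
  have "eqmod M (uP * base_poly W0 * base_poly W0)
      (cP \<alpha>3 * uP * vP * (cP \<alpha>2 * uP + cP \<alpha>3 * vP + cP \<alpha>4 * uP * vP))"
    by (rule eqmod_mult[OF u_W0_eqmod W0_eqmod])
  then show ?thesis by (simp add: algebra_simps uP_vP_nilpotent eqmod_0_iff power2_eq_square)
qed

lemma W0_sq: "eqmod M (base_poly W0 ^ 2) (2 * cP \<alpha>2 * uP * base_poly W0)"
proof -
  let ?N = "cP \<alpha>2 * uP + cP \<alpha>3 * vP + cP \<alpha>4 * uP * vP"
  have "eqmod M (base_poly W0 ^ 2) (?N ^ 2)" by (rule eqmod_power[OF W0_eqmod])
  also have "?N ^ 2 = 2 * cP \<alpha>2 * (cP \<alpha>3 * uP * vP)"
    by (simp add: algebra_simps power2_eq_square uP_vP_nilpotent)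
  also have "eqmod M \<dots> (2 * cP \<alpha>2 * (uP * base_poly W0))"
    by (intro eqmod_mult eqmod_refl eqmod_sym[OF u_W0_eqmod])
  finally show ?thesis by (simp add: mult.assoc)
qed

text \<open>
  If \<open>u f = (x\<^sup>n - \<alpha>) P\<close>, comparing components with respect to \<open>1, u, v, uv\<close> shows that the components
  of \<open>P\<close> at \<open>1\<close> and \<open>v\<close> vanish, that \<open>f = W0 P\<^sub>u\<close>, and that \<open>\<alpha>\<^sub>3 P\<^sub>u = W0 P\<^sub>u\<^sub>v\<close>.  The factor \<open>W0\<close> thus occurs twice.
\<close>

lemma u_base_dvd_iff: "M dvd uP * base_poly f \<longleftrightarrow> W0 ^ 2 dvd f"
proof
  assume "W0 ^ 2 dvd f"
  then obtain g where "f = W0 ^ 2 * g" by (elim dvdE)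
  then show "M dvd uP * base_poly f"
    using dvd_mult2[OF u_W0_sq, of "base_poly g"] by (simp add: base_poly_mult base_poly_power mult.assoc)
next
  assume "M dvd uP * base_poly f"
  then obtain P where P: "uP * base_poly f = M * P" by (elim dvdE)
  obtain f0 f1 f2 f3 where
    "P = base_poly f0 + uP * base_poly f1 + vP * base_poly f2 + uP * vP * base_poly f3"
    using uv_decompose by blast
  with P have "base_poly (W0 * f0) + uP * base_poly (W0 * f1 - [:\<alpha>2:] * f0 - f)
      + vP * base_poly (W0 * f2 - [:\<alpha>3:] * f0)
      + uP * vP * base_poly (W0 * f3 - [:\<alpha>2:] * f2 - [:\<alpha>3:] * f1 - [:\<alpha>4:] * f0) = 0"
    by (simp only: modulus_split base_poly_mult base_poly_diff base_poly_const)
      (simp add: algebra_simps uP_vP_nilpotent)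
  note comp = uv_decomposition_zero[OF this]
  have "Polynomial.coeff W0 n = 1"
    using n_pos by (simp add: W0_def monom_power coeff_pCons split: nat.splits)
  then have W0: "W0 \<noteq> 0" by auto
  have "f0 = 0" using comp(1) W0 by simp
  moreover from this have "f2 = 0" using comp(3) W0 by simp
  ultimately have f: "f = W0 * f1" and f3: "[:\<alpha>3:] * f1 = W0 * f3" using comp(2,4) by simp_all
  have "f1 = [:inverse \<alpha>3:] * ([:\<alpha>3:] * f1)" using alpha3 by simp
  also have "\<dots> = W0 * ([:inverse \<alpha>3:] * f3)" unfolding f3 by (simp add: mult_ac)
  finally show "W0 ^ 2 dvd f" unfolding f power2_eq_square by (metis dvd_triv_left mult.assoc)
qed

text \<open>
  Multiplying \<open>W0 = \<alpha>\<^sub>2 u + \<alpha>\<^sub>3 v + \<alpha>\<^sub>4 uv\<close> by \<open>u\<close> expresses \<open>uv\<close> through \<open>u W0\<close>; inserting this, the same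
  relation expresses \<open>v\<close>.
\<close>

lemma u_form: "\<exists>f g. eqmod M P (base_poly f + uP * base_poly g)"
proof -
  obtain f0 f1 f2 f3 where P:
    "P = base_poly f0 + uP * base_poly f1 + vP * base_poly f2 + uP * vP * base_poly f3"
    using uv_decompose by blast
  have inv3: "cP (inverse \<alpha>3) * cP \<alpha>3 = 1" using alpha3 by (simp add: cP_mult[symmetric] cP_1)
  have uv: "eqmod M (uP * vP) (cP (inverse \<alpha>3) * (uP * base_poly W0))"
  proof -
    have "eqmod M (cP (inverse \<alpha>3) * (uP * base_poly W0)) (cP (inverse \<alpha>3) * (cP \<alpha>3 * uP * vP))"
      by (rule eqmod_mult[OF eqmod_refl u_W0_eqmod])
    also have "cP (inverse \<alpha>3) * (cP \<alpha>3 * uP * vP) = uP * vP" by (simp add: mult.assoc[symmetric] inv3)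
    finally show ?thesis by (rule eqmod_sym)
  qed
  have v: "eqmod M vP (cP (inverse \<alpha>3) *
      (base_poly W0 - cP \<alpha>2 * uP - cP \<alpha>4 * (cP (inverse \<alpha>3) * (uP * base_poly W0))))"
  proof -
    have "vP = cP (inverse \<alpha>3) * cP \<alpha>3 * vP" by (simp add: inv3)
    also have "\<dots> = cP (inverse \<alpha>3) * ((cP \<alpha>2 * uP + cP \<alpha>3 * vP + cP \<alpha>4 * uP * vP)
        - cP \<alpha>2 * uP - cP \<alpha>4 * (uP * vP))" by (simp add: algebra_simps)
    also have "eqmod M \<dots> (cP (inverse \<alpha>3) *
      (base_poly W0 - cP \<alpha>2 * uP - cP \<alpha>4 * (cP (inverse \<alpha>3) * (uP * base_poly W0))))"
      by (intro eqmod_mult eqmod_diff eqmod_refl uv eqmod_sym[OF W0_eqmod])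
    finally show ?thesis .
  qed
  let ?i = "[:inverse \<alpha>3:]"
  have "eqmod M P (base_poly f0 + uP * base_poly f1
     + (cP (inverse \<alpha>3) * (base_poly W0 - cP \<alpha>2 * uP
          - cP \<alpha>4 * (cP (inverse \<alpha>3) * (uP * base_poly W0)))) * base_poly f2
     + (cP (inverse \<alpha>3) * (uP * base_poly W0)) * base_poly f3)"
    unfolding P by (intro eqmod_add eqmod_mult eqmod_refl uv v)
  also have "\<dots> = base_poly (f0 + ?i * W0 * f2)
     + uP * base_poly (f1 - ?i * [:\<alpha>2:] * f2 - ?i * [:\<alpha>4:] * ?i * W0 * f2 + ?i * W0 * f3)"
    by (simp only: base_poly_add base_poly_diff base_poly_mult base_poly_const)
       (simp only: algebra_simps)
  finally show ?thesis by blast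
qed

text \<open>
  The bounds on \<open>l\<close>, \<open>t\<close>, \<open>\<mu>\<close> say that every exponent in the generators of the annihilator is a
  genuine difference and that \<open>w\<^sup>\<mu>\<close> divides \<open>w\<^sup>l\<close>.  The polynomial \<open>Z\<close> may have coefficients outside
  \<open>F\<close>: it only occurs multiplied by \<open>u\<close>, and such a product is again of the form \<open>u s\<close> with
  \<open>s \<in> F[x]\<close>.
\<close>

lemma annihilator_generators:
  fixes w :: "'a poly" and Z :: "'a uvring poly" and q l t mu :: nat
  defines "W \<equiv> base_poly w"
  assumes wq: "w ^ q = W0" and w0: "w \<noteq> 0" and l: "l \<le> 2 * q" and muq: "mu \<le> q" and mul: "mu \<le> l"
    and t: "mu + l \<le> 2 * q + t"
  shows "annihilator (consta_ring n \<alpha>) (consta_ideal n \<alpha> {W ^ l + uP * W ^ t * Z, uP * W ^ mu})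
    = consta_ideal n \<alpha>
        {W ^ (2 * q - mu) - 2 * cP \<alpha>2 * uP * W ^ (q - mu) - uP * W ^ (2 * q + t - l - mu) * Z,
         uP * W ^ (2 * q - l)}" (is "?A = consta_ideal n \<alpha> {?G, ?H}")
proof -
  have Wq: "W ^ q = base_poly W0" unfolding W_def wq[symmetric] by (simp add: base_poly_power)
  have W2q: "W ^ (2 * q) = base_poly W0 ^ 2"
    by (simp add: Wq[symmetric] power_mult mult.commute[of 2])
  have uW2q: "M dvd uP * W ^ (2 * q)" using u_W0_sq unfolding W2q .
  have dvd_w: "w ^ (2 * q - i) dvd f" if "M dvd uP * base_poly (f * w ^ i)" "i \<le> 2 * q" for f i
  proof -
    have "w ^ (2 * q - i) * w ^ i dvd f * w ^ i"
      using that u_base_dvd_iff[of "f * w ^ i"]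
      by (simp add: power_add[symmetric] wq[symmetric] power_mult[symmetric] mult.commute)
    then show ?thesis using w0 by simp
  qed
  let ?g1 = "W ^ l + uP * W ^ t * Z" and ?g2 = "uP * W ^ mu"
  have Gg1: "M dvd ?G * ?g1"
  proof -
    have e: "W ^ (2 * q - mu) * W ^ l = W ^ (l - mu) * W ^ (2 * q)"
      "W ^ (q - mu) * W ^ l = W ^ (l - mu) * W ^ q"
      "W ^ (2 * q - mu) * W ^ t = W ^ (2 * q + t - l - mu) * W ^ l"
      using muq mul t by (simp_all add: power_add[symmetric] add.commute)
    have "(A - 2 * c * uP * B - uP * D * Z) * (L + uP * T * Z)
        = A * L - 2 * c * uP * (B * L) + uP * Z * (A * T - D * L)" for A B c D L T
      by (simp add: algebra_simps uP_vP_nilpotent)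
    then have "?G * ?g1 = W ^ (l - mu) * (base_poly W0 ^ 2 - 2 * cP \<alpha>2 * uP * base_poly W0)"
      by (simp only: e W2q Wq) (simp add: algebra_simps)
    then show ?thesis using W0_sq unfolding eqmod_def by simp
  qed
  have Gg2: "M dvd ?G * ?g2"
  proof -
    have "?G * ?g2 = uP * (W ^ (2 * q - mu) * W ^ mu)" by (simp add: algebra_simps uP_vP_nilpotent)
    also have "W ^ (2 * q - mu) * W ^ mu = W ^ (2 * q)" using muq by (simp add: power_add[symmetric])
    finally show ?thesis using uW2q by simp
  qed
  have Hg1: "M dvd ?H * ?g1"
  proof -
    have "?H * ?g1 = uP * (W ^ (2 * q - l) * W ^ l)" by (simp add: algebra_simps uP_vP_nilpotent)
    also have "W ^ (2 * q - l) * W ^ l = W ^ (2 * q)" using l by (simp add: power_add[symmetric])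
    finally show ?thesis using uW2q by simp
  qed
  have Hg2: "?H * ?g2 = 0" by (simp add: algebra_simps uP_vP_nilpotent)
  have "M dvd f * (W ^ l + uP * W ^ t * Z) \<and> M dvd f * (uP * W ^ mu) \<longleftrightarrow>
      (\<exists>A B. eqmod M f (A * ?G + B * ?H))" (is "?L f \<longleftrightarrow> ?R f") for f
  proof
    assume L: "?L f"
    obtain f0 f1 where f: "eqmod M f (base_poly f0 + uP * base_poly f1)" using u_form by blast
    have "eqmod M (f * (uP * W ^ mu)) ((base_poly f0 + uP * base_poly f1) * (uP * W ^ mu))"
      by (rule eqmod_mult[OF f eqmod_refl])
    also have "(base_poly f0 + uP * base_poly f1) * (uP * W ^ mu) = uP * base_poly (f0 * w ^ mu)"
      by (simp add: algebra_simps uP_vP_nilpotent W_def base_poly_mult base_poly_power)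
    finally have "M dvd uP * base_poly (f0 * w ^ mu)" using L eqmod_dvd by blast
    then obtain g where g: "f0 = w ^ (2 * q - mu) * g" using dvd_w[of f0 mu] muq by (auto elim!: dvdE)
    \<comment> \<open>The part of \<open>f - g G\<close> that is divisible by \<open>u\<close>.\<close>
    define S where "S = base_poly f1 + base_poly g *
      (2 * cP \<alpha>2 * W ^ (q - mu) + W ^ (2 * q + t - l - mu) * Z)"
    obtain s s' where s: "eqmod M S (base_poly s + uP * base_poly s')" using u_form by blast
    have "base_poly f0 + uP * base_poly f1 = base_poly g * ?G + uP * S"
      unfolding g S_def by (simp add: algebra_simps W_def base_poly_mult base_poly_power)
    then have fS: "eqmod M f (base_poly g * ?G + uP * S)" using f by simp
    also have "eqmod M \<dots> (base_poly g * ?G + uP * (base_poly s + uP * base_poly s'))"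
      by (intro eqmod_add eqmod_mult eqmod_refl s)
    finally have fs: "eqmod M f (base_poly g * ?G + uP * base_poly s)"
      by (simp add: distrib_left uP_vP_nilpotent)
    have "M dvd f * ?g1 - base_poly g * (?G * ?g1)"
      using L Gg1 by (intro dvd_diff dvd_mult[of _ "?G * ?g1"]) auto
    moreover have "eqmod M (f * ?g1) ((base_poly g * ?G + uP * base_poly s) * ?g1)"
      by (rule eqmod_mult[OF fs eqmod_refl])
    then have "eqmod M (f * ?g1 - base_poly g * (?G * ?g1)) (uP * base_poly s * ?g1)"
      by (simp add: eqmod_def algebra_simps)
    moreover have "uP * base_poly s * ?g1 = uP * base_poly (s * w ^ l)"
      by (simp add: algebra_simps uP_vP_nilpotent W_def base_poly_mult base_poly_power)
    ultimately have "M dvd uP * base_poly (s * w ^ l)" using eqmod_dvd by metis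
    then obtain s1 where "s = w ^ (2 * q - l) * s1" using dvd_w[of s l] l by (auto elim!: dvdE)
    then have "uP * base_poly s = base_poly s1 * ?H"
      by (simp add: W_def base_poly_mult base_poly_power mult_ac)
    then show "?R f" using fs by metis
  next
    assume "?R f"
    then obtain A B where f: "eqmod M f (A * ?G + B * ?H)" by blast
    have "M dvd f * g" if "M dvd ?G * g" "M dvd ?H * g" for g
    proof -
      have "M dvd A * (?G * g) + B * (?H * g)"
        using that by (intro dvd_add dvd_mult[of _ "?G * g"] dvd_mult[of _ "?H * g"]) auto
      moreover have "A * (?G * g) + B * (?H * g) = (A * ?G + B * ?H) * g"
        by (simp only: ring_distribs mult.assoc)
      ultimately show ?thesis using eqmod_dvd[OF eqmod_mult[OF f eqmod_refl[of _ g]]] by simp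
    qed
    then show "?L f" using Gg1 Gg2 Hg1 Hg2 by simp
  qed
  then have "consta_class n \<alpha> f \<in> ?A \<longleftrightarrow> consta_class n \<alpha> f \<in> consta_ideal n \<alpha> {?G, ?H}" for f
    by (simp add: consta_class_in_annihilator_two_gens consta_class_in_ideal_iff)
  moreover have "?A \<subseteq> range (consta_class n \<alpha>)"
    by (auto simp: annihilator_def consta_ring_carrier)
  moreover have "consta_ideal n \<alpha> {?G, ?H} \<subseteq> range (consta_class n \<alpha>)"
    by (auto simp: consta_ideal_two_gens)
  ultimately show ?thesis by blast
qed

end


section \<open>The Frobenius power of the cubic\<close>

text \<open>
  Adding \<open>1\<close> permutes the field, so the sum of all its elements equals itself plus \<open>CARD('a)\<close>;
  hence \<open>CARD('a) = p\<^sup>m\<close> vanishes in the field, and then so does \<open>p\<close>.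
\<close>

lemma finite_field_of_nat_root_card:
  fixes p m :: nat
  assumes "CARD('a::{field,finite}) = p ^ m"
  shows "of_nat p = (0 :: 'a)"
proof -
  have "(\<Sum>x\<in>UNIV. x + 1) = (\<Sum>x\<in>UNIV. x :: 'a)"
    by (rule sum.reindex_bij_betw[of "\<lambda>x. x + 1" UNIV UNIV "\<lambda>x. x"]) (rule bij_plus_right)
  then have "(\<Sum>x\<in>(UNIV :: 'a set). 1 :: 'a) = 0" by (simp add: sum.distrib)
  then have "of_nat p ^ m = (0 :: 'a)" using assms by simp
  then show ?thesis using power_not_zero by blast
qed

text \<open>
  Multiplication by \<open>x \<noteq> 0\<close> permutes the nonzero elements, so it does not change their product.
\<close>

lemma finite_field_power_card:
  fixes x :: "'a::{field,finite}"
  shows "x ^ CARD('a) = x"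
proof (cases "x = 0")
  case False
  let ?U = "UNIV - {0 :: 'a}"
  have "bij_betw (\<lambda>y. x * y) ?U ?U"
    by (rule bij_betwI[of _ _ _ "\<lambda>y. inverse x * y"]) (use False in auto)
  then have "(\<Prod>y\<in>?U. x * y) = (\<Prod>y\<in>?U. y)" by (rule prod.reindex_bij_betw)
  then have "x ^ card ?U * (\<Prod>y\<in>?U. y) = (\<Prod>y\<in>?U. y)" by (simp only: prod.distrib prod_constant)
  moreover have "(\<Prod>y\<in>?U. y) \<noteq> 0" by (simp add: prod_zero_iff)
  ultimately have "x ^ card ?U = 1" by (metis mult_cancel_right1)
  moreover have "CARD('a) = Suc (card ?U)" by (rule card.remove) simp_all
  ultimately show ?thesis by (simp only: power_Suc mult_1_right)
qed (simp add: zero_power)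

text \<open>
  The element \<open>\<alpha>\<^sub>0\<close> is the \<open>p\<^sup>s\<close>-th root of \<open>\<alpha>\<^sub>1\<close>: the exponents add up to \<open>m - r\<^sub>0 + s = m (q\<^sub>0 + 1)\<close>, and
  raising to the power \<open>p\<^sup>m\<close> is the identity of the field.
\<close>

lemma x_cube_minus_power:
  fixes \<alpha>0 \<alpha>1 :: "'a::{field,finite}"
  assumes "prime p" and card: "CARD('a) = p ^ m" and s: "s = q0 * m + r0" and r0: "r0 \<le> m - 1"
    and \<alpha>0: "\<alpha>0 = \<alpha>1 ^ (p ^ (m - r0))"
  shows "(Polynomial.monom 1 1 ^ 3 - [:\<alpha>0:]) ^ (p ^ s) = Polynomial.monom 1 1 ^ (3 * p ^ s) - [:\<alpha>1:]"
proof -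
  have "CHAR('a) dvd p"
    using finite_field_of_nat_root_card[OF card] by (simp add: of_nat_eq_0_iff_char_dvd)
  then have char: "CHAR('a poly) = p"
    using \<open>prime p\<close> CHAR_not_1[where ?'a = 'a] by (auto simp: prime_nat_iff)
  have "card {0, 1 :: 'a} \<le> CARD('a)" by (rule card_mono) simp_all
  then have "m \<noteq> 0" using card by (intro notI) simp
  then have e: "m - r0 + s = m * Suc q0" using s r0 by (simp add: mult.commute)
  have iter: "x ^ (p ^ (m * k)) = x" for x :: 'a and k
  proof (induction k)
    case (Suc k)
    have "x ^ (p ^ (m * Suc k)) = (x ^ (p ^ (m * k))) ^ (p ^ m)"
      by (simp only: power_mult[symmetric] power_add[symmetric] mult_Suc_right add.commute)
    then show ?case unfolding Suc card[symmetric] finite_field_power_card .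
  qed simp
  have "\<alpha>0 ^ (p ^ s) = \<alpha>1 ^ (p ^ (m - r0 + s))"
    unfolding \<alpha>0 by (simp only: power_mult[symmetric] power_add[symmetric])
  also have "\<dots> = \<alpha>1" unfolding e by (rule iter)
  finally have const: "[:\<alpha>0:] ^ (p ^ s) = [:\<alpha>1:]" by (simp only: poly_const_pow)
  let ?x3 = "Polynomial.monom 1 1 ^ 3 :: 'a poly"
  have "?x3 ^ (p ^ s) = (?x3 - [:\<alpha>0:] + [:\<alpha>0:]) ^ (p ^ s)" by (simp only: diff_add_cancel)
  also have "\<dots> = (?x3 - [:\<alpha>0:]) ^ (p ^ s) + [:\<alpha>0:] ^ (p ^ s)"
    by (rule freshmans_dream'[where n = s]) (use \<open>prime p\<close> in \<open>simp_all only: char\<close>)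
  finally have "?x3 ^ (p ^ s) = (?x3 - [:\<alpha>0:]) ^ (p ^ s) + [:\<alpha>1:]" unfolding const .
  moreover have "Polynomial.monom 1 1 ^ (3 * p ^ s) = ?x3 ^ (p ^ s)" by (rule power_mult)
  ultimately show ?thesis by (simp only: add_diff_cancel_right')
qed


section \<open>Generators of the reciprocal annihilator\<close>

lemma consta_ideal_unit_multiples:
  assumes g1: "eqmod (consta_modulus n b) (e1 * g1) h1" and e1: "eqmod (consta_modulus n b) (d1 * e1) 1"
    and g2: "eqmod (consta_modulus n b) (e2 * g2) h2" and e2: "eqmod (consta_modulus n b) (d2 * e2) 1"
  shows "consta_ideal n b {g1, g2} = consta_ideal n b {h1, h2}"
proof -
  let ?m = "consta_modulus n b"
  have divide: "eqmod ?m g (d * h)" if "eqmod ?m (e * g) h" "eqmod ?m (d * e) 1" for g h e d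
  proof -
    have "eqmod ?m g (d * e * g)"
      using eqmod_mult[OF eqmod_sym[OF that(2)] eqmod_refl[of _ g]] by simp
    also have "eqmod ?m (d * e * g) (d * h)"
      using eqmod_mult[OF eqmod_refl[of _ d] that(1)] by (simp add: mult.assoc)
    finally show ?thesis .
  qed
  have "(\<exists>A B. eqmod ?m f (A * g1 + B * g2)) \<longleftrightarrow> (\<exists>A B. eqmod ?m f (A * h1 + B * h2))" for f
  proof
    assume "\<exists>A B. eqmod ?m f (A * g1 + B * g2)"
    then obtain A B where "eqmod ?m f (A * g1 + B * g2)" by blast
    also have "eqmod ?m (A * g1 + B * g2) (A * (d1 * h1) + B * (d2 * h2))"
      by (intro eqmod_add eqmod_mult eqmod_refl divide[OF g1 e1] divide[OF g2 e2])
    finally show "\<exists>A B. eqmod ?m f (A * h1 + B * h2)" by (metis mult.assoc)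
  next
    assume "\<exists>A B. eqmod ?m f (A * h1 + B * h2)"
    then obtain A B where "eqmod ?m f (A * h1 + B * h2)" by blast
    also have "eqmod ?m (A * h1 + B * h2) (A * (e1 * g1) + B * (e2 * g2))"
      by (intro eqmod_add eqmod_mult eqmod_refl eqmod_sym[OF g1] eqmod_sym[OF g2])
    finally show "\<exists>A B. eqmod ?m f (A * g1 + B * g2)" by (metis mult.assoc)
  qed
  then have "consta_class n b f \<in> consta_ideal n b {g1, g2} \<longleftrightarrow>
      consta_class n b f \<in> consta_ideal n b {h1, h2}" for f
    by (simp add: consta_class_in_ideal_iff)
  moreover have "consta_ideal n b {g, h} \<subseteq> range (consta_class n b)" for g h
    by (auto simp: consta_ideal_two_gens)
  ultimately show ?thesis by blast
qed

text \<open>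
  The substitutions of \<open>x\<^sup>-\<^sup>1\<close> are inverse to each other on classes, so they carry generators of the
  annihilator to generators of its reciprocal.
\<close>

lemma annihilator_star_two_gens:
  fixes a :: "'r::comm_ring_1"
  assumes ab: "a * b = 1" and b: "b = unit_inv a" and n: "0 < n"
    and I: "I \<subseteq> carrier (consta_ring n a)"
    and ann: "annihilator (consta_ring n a) I = consta_ideal n a {G, H}"
  shows "annihilator_star n a I = consta_ideal n b {invert_x n a G, invert_x n a H}"
proof -
  let ?a = "consta_modulus n a" and ?b = "consta_modulus n b"
  let ?f = "invert_x n a" and ?g = "invert_x n b"
  have ba: "b * a = 1" using ab by (simp add: mult.commute)
  have "consta_class n b g \<in> annihilator_star n a I \<longleftrightarrow>
      consta_class n b g \<in> consta_ideal n b {?f G, ?f H}" for g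
  proof -
    have "consta_class n b g \<in> annihilator_star n a I \<longleftrightarrow>
        (\<exists>A B. eqmod ?a (?g g) (A * G + B * H))"
      by (simp add: consta_class_in_star_iff[OF ab b n I] ann consta_class_in_ideal_iff)
    also have "\<dots> \<longleftrightarrow> (\<exists>A B. eqmod ?b g (A * ?f G + B * ?f H))"
    proof
      assume "\<exists>A B. eqmod ?a (?g g) (A * G + B * H)"
      then obtain A B where "eqmod ?a (?g g) (A * G + B * H)" by blast
      from eqmod_invert_x[OF ab n this]
      have "eqmod ?b (?f (?g g)) (?f A * ?f G + ?f B * ?f H)"
        by (simp only: invert_x_add invert_x_mult)
      with eqmod_trans[OF eqmod_sym[OF invert_x_invert_x[OF ba n, of g]]]
      show "\<exists>A B. eqmod ?b g (A * ?f G + B * ?f H)" by blast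
    next
      assume "\<exists>A B. eqmod ?b g (A * ?f G + B * ?f H)"
      then obtain A B where "eqmod ?b g (A * ?f G + B * ?f H)" by blast
      from eqmod_invert_x[OF ba n this]
      have "eqmod ?a (?g g) (?g A * ?g (?f G) + ?g B * ?g (?f H))"
        by (simp only: invert_x_add invert_x_mult)
      also have "eqmod ?a \<dots> (?g A * G + ?g B * H)"
        by (intro eqmod_add eqmod_mult eqmod_refl invert_x_invert_x ab n)
      finally show "\<exists>A B. eqmod ?a (?g g) (A * G + B * H)" by blast
    qed
    finally show ?thesis by (simp add: consta_class_in_ideal_iff)
  qed
  moreover have "annihilator_star n a I \<subseteq> range (consta_class n b)"
    by (auto simp: annihilator_star_def b)
  moreover have "consta_ideal n b {?f G, ?f H} \<subseteq> range (consta_class n b)"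
    by (auto simp: consta_ideal_two_gens)
  ultimately show ?thesis by blast
qed

locale x_reversal =
  fixes n :: nat and \<alpha> \<beta> :: "'a::field uvring"
  assumes \<alpha>\<beta>: "\<alpha> * \<beta> = 1" and n: "0 < n"
begin

abbreviation "M' \<equiv> consta_modulus n \<beta>"
abbreviation "flip \<equiv> invert_x n \<alpha>"

lemma flip_atoms: "flip (cP c) = cP c" "flip uP = uP" "flip xP = Polynomial.monom \<alpha> (n - 1)"
  by (simp_all add: cP_def uP_def invert_x_const xP_def invert_x_x[simplified])

lemma x_flip_x: "eqmod M' (xP * flip xP) 1"
  using x_inverse[of \<beta> \<alpha> n] \<alpha>\<beta> n unfolding flip_atoms by (simp add: xP_def mult.commute)

lemma x_power_flip: "eqmod M' (xP ^ k * flip xP ^ k) 1"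
  using eqmod_power[OF x_flip_x, of k] by (simp add: power_mult_distrib)

end

text \<open>
  Substituting \<open>x\<^sup>-\<^sup>1\<close> into a polynomial in \<open>x\<^sup>3 - \<alpha>\<^sub>0\<close> and clearing denominators by powers of \<open>x\<close> gives
  polynomials in \<open>1 - \<alpha>\<^sub>0 x\<^sup>3 = - \<alpha>\<^sub>0 (x\<^sup>3 - \<alpha>\<^sub>0\<^sup>-\<^sup>1)\<close>.
\<close>

locale cubic_reversal = x_reversal n \<alpha> \<beta>
  for n :: nat and \<alpha> \<beta> :: "'a::field uvring" +
  fixes \<alpha>0 :: 'a
  assumes \<alpha>0: "\<alpha>0 \<noteq> 0"
begin

abbreviation V :: "'a uvring poly" where
  "V \<equiv> xP ^ 3 - cP (inverse \<alpha>0)"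

lemma reverse_cubic: "eqmod M' (xP ^ 3 * flip (xP ^ 3 - cP \<alpha>0)) (cP (- \<alpha>0) * V)"
proof -
  have "xP ^ 3 * flip (xP ^ 3 - cP \<alpha>0) = xP ^ 3 * flip xP ^ 3 - cP \<alpha>0 * xP ^ 3"
    by (simp only: invert_x_diff invert_x_power flip_atoms right_diff_distrib mult.commute)
  also have "eqmod M' \<dots> (1 - cP \<alpha>0 * xP ^ 3)"
    by (intro eqmod_diff eqmod_refl x_power_flip)
  also have "1 - cP \<alpha>0 * xP ^ 3 = cP (- \<alpha>0) * V"
  proof -
    have "cP (- \<alpha>0) = - cP \<alpha>0" using cP_diff[of 0 \<alpha>0] by (simp add: cP_0)
    moreover have "cP \<alpha>0 * cP (inverse \<alpha>0) = 1" using \<alpha>0 by (simp add: cP_mult[symmetric] cP_1)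
    ultimately show ?thesis by (simp add: right_diff_distrib)
  qed
  finally show ?thesis .
qed

lemma reverse_cubic_power:
  "eqmod M' (xP ^ (3 * k) * flip ((xP ^ 3 - cP \<alpha>0) ^ k)) (cP ((- \<alpha>0) ^ k) * V ^ k)"
  using eqmod_power[OF reverse_cubic, of k]
  by (simp only: power_mult_distrib power_mult invert_x_power cP_power)

lemma reverse_quadratic:
  "eqmod M' (xP ^ 2 * flip (cP c0 * xP\<^sup>2 + cP c1 * xP + cP c2)) (cP c2 * xP\<^sup>2 + cP c1 * xP + cP c0)"
proof -
  have "xP ^ 2 * flip (cP c0 * xP\<^sup>2 + cP c1 * xP + cP c2)
      = cP c2 * xP\<^sup>2 + cP c1 * xP * (xP * flip xP) + cP c0 * (xP ^ 2 * flip xP ^ 2)"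
    by (simp only: invert_x_add invert_x_mult invert_x_power flip_atoms power2_eq_square)
      (simp only: algebra_simps)
  also have "eqmod M' \<dots> (cP c2 * xP\<^sup>2 + cP c1 * xP * 1 + cP c0 * 1)"
    by (intro eqmod_add eqmod_mult eqmod_refl x_flip_x x_power_flip)
  finally show ?thesis by simp
qed

text \<open>
  The hypothesis \<open>K \<le> N\<close> gives \<open>3 k + 2 \<le> 3 N\<close> for all \<open>k < K\<close>, so \<open>x\<^bsup>3N\<^esup>\<close> clears the denominators
  \<open>x\<^sup>2\<close> and \<open>x\<^bsup>3k\<^esup>\<close> of each summand and leaves \<open>x\<^bsup>3N-3k-2\<^esup>\<close>.  In the quadratic factor the outer coefficients
  trade places.
\<close>

lemma reverse_z:
  assumes "K \<le> N"
  shows "eqmod M'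
    (xP ^ (3 * N) * flip (\<Sum>k<K. (cP (z0 k) * xP\<^sup>2 + cP (z1 k) * xP + cP (z2 k)) * (xP ^ 3 - cP \<alpha>0) ^ k))
    (\<Sum>k<K. (cP (z2 k) * xP\<^sup>2 + cP (z1 k) * xP + cP (z0 k)) * cP ((- \<alpha>0) ^ k) * V ^ k
        * xP ^ (3 * N - 3 * k - 2))"
  unfolding invert_x_sum sum_distrib_left
proof (rule eqmod_sum)
  fix k assume "k \<in> {..<K}"
  then have e: "3 * N = 2 + (3 * k + (3 * N - 3 * k - 2))" using assms by auto
  let ?P = "cP (z0 k) * xP\<^sup>2 + cP (z1 k) * xP + cP (z2 k)"
  let ?E = "xP ^ (3 * N - 3 * k - 2)"
  have "xP ^ (3 * N) * flip (?P * (xP ^ 3 - cP \<alpha>0) ^ k)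
      = (xP ^ 2 * flip ?P) * (xP ^ (3 * k) * flip ((xP ^ 3 - cP \<alpha>0) ^ k)) * ?E"
    by (subst e) (simp only: power_add invert_x_mult mult_ac)
  also have "eqmod M' \<dots> ((cP (z2 k) * xP\<^sup>2 + cP (z1 k) * xP + cP (z0 k))
      * (cP ((- \<alpha>0) ^ k) * V ^ k) * ?E)"
    by (rule eqmod_mult[OF eqmod_mult[OF reverse_quadratic reverse_cubic_power] eqmod_refl])
  finally show "eqmod M' (xP ^ (3 * N) * flip (?P * (xP ^ 3 - cP \<alpha>0) ^ k))
      ((cP (z2 k) * xP\<^sup>2 + cP (z1 k) * xP + cP (z0 k)) * cP ((- \<alpha>0) ^ k) * V ^ k * ?E)"
    by (simp only: mult.assoc)
qed

text \<open>
  The unit \<open>x\<^bsup>3(2q-\<mu>)\<^esup>\<close> is what the leading term needs.  In the middle term \<open>x\<^bsup>3(q-\<mu>)\<^esup>\<close> of it is used up and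
  \<open>x\<^bsup>3q\<^esup>\<close> is left over; in the last term \<open>x\<^bsup>3(l-t)\<^esup>\<close> is left over and clears the denominators of the sum.
\<close>

lemma reverse_first_generator:
  fixes z0 z1 z2 :: "nat \<Rightarrow> 'a"
  assumes "mu \<le> q" "mu \<le> l" "t \<le> l" "mu + l \<le> 2 * q + t"
  shows "eqmod M' (xP ^ (3 * (2 * q - mu)) * flip (
      (xP ^ 3 - cP \<alpha>0) ^ (2 * q - mu) - 2 * cP \<alpha>2 * uP * (xP ^ 3 - cP \<alpha>0) ^ (q - mu)
      - uP * (xP ^ 3 - cP \<alpha>0) ^ (2 * q + t - l - mu)
        * (\<Sum>k<mu - t. (cP (z0 k) * xP\<^sup>2 + cP (z1 k) * xP + cP (z2 k)) * (xP ^ 3 - cP \<alpha>0) ^ k)))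
    (psi2 q \<alpha>0 \<alpha>2 l t mu z0 z1 z2)"
proof -
  let ?w = "xP ^ 3 - cP \<alpha>0"
  let ?Z = "\<Sum>k<mu - t. (cP (z0 k) * xP\<^sup>2 + cP (z1 k) * xP + cP (z2 k)) * ?w ^ k"
  let ?S = "\<Sum>k<mu - t. (cP (z2 k) * xP\<^sup>2 + cP (z1 k) * xP + cP (z0 k))
              * cP ((- \<alpha>0) ^ k) * V ^ k * xP ^ (3 * l - 3 * t - 3 * k - 2)"
  have Z: "eqmod M' (xP ^ (3 * (l - t)) * flip ?Z) ?S"
    using reverse_z[of "mu - t" "l - t" z0 z1 z2] assms by (simp add: diff_mult_distrib2)
  have flip2: "flip 2 = 2"
    using invert_x_add[of n \<alpha> 1 1] by (simp add: invert_x_1)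
  have e1: "xP ^ (3 * (2 * q - mu)) = xP ^ (3 * (q - mu)) * xP ^ (3 * q)"
    using assms by (simp add: power_add[symmetric] algebra_simps)
  have e2: "xP ^ (3 * (2 * q - mu)) = xP ^ (3 * (2 * q + t - l - mu)) * xP ^ (3 * (l - t))"
    using assms by (simp add: power_add[symmetric] add_mult_distrib2[symmetric])
  have expand: "xP ^ (3 * (2 * q - mu)) * flip (?w ^ (2 * q - mu) - 2 * cP \<alpha>2 * uP * ?w ^ (q - mu)
        - uP * ?w ^ (2 * q + t - l - mu) * ?Z)
      = xP ^ (3 * (2 * q - mu)) * flip (?w ^ (2 * q - mu))
        - xP ^ (3 * (2 * q - mu)) * (2 * cP \<alpha>2 * uP * flip (?w ^ (q - mu)))
        - xP ^ (3 * (2 * q - mu)) * (uP * flip (?w ^ (2 * q + t - l - mu)) * flip ?Z)"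
    by (simp only: invert_x_diff invert_x_mult flip_atoms flip2 right_diff_distrib)
  have middle: "xP ^ (3 * (2 * q - mu)) * (2 * cP \<alpha>2 * uP * flip (?w ^ (q - mu)))
        = 2 * cP \<alpha>2 * uP * (xP ^ (3 * (q - mu)) * flip (?w ^ (q - mu))) * xP ^ (3 * q)"
    by (subst e1) (simp only: mult_ac)
  have last: "xP ^ (3 * (2 * q - mu)) * (uP * flip (?w ^ (2 * q + t - l - mu)) * flip ?Z)
        = uP * (xP ^ (3 * (2 * q + t - l - mu)) * flip (?w ^ (2 * q + t - l - mu)))
          * (xP ^ (3 * (l - t)) * flip ?Z)"
    by (subst e2) (simp only: mult_ac)
  have "eqmod M' (xP ^ (3 * (2 * q - mu)) * flip (?w ^ (2 * q - mu))
        - 2 * cP \<alpha>2 * uP * (xP ^ (3 * (q - mu)) * flip (?w ^ (q - mu))) * xP ^ (3 * q)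
        - uP * (xP ^ (3 * (2 * q + t - l - mu)) * flip (?w ^ (2 * q + t - l - mu)))
          * (xP ^ (3 * (l - t)) * flip ?Z))
      (cP ((- \<alpha>0) ^ (2 * q - mu)) * V ^ (2 * q - mu)
        - 2 * cP \<alpha>2 * uP * (cP ((- \<alpha>0) ^ (q - mu)) * V ^ (q - mu)) * xP ^ (3 * q)
        - uP * (cP ((- \<alpha>0) ^ (2 * q + t - l - mu)) * V ^ (2 * q + t - l - mu)) * ?S)"
    by (rule eqmod_diff[OF eqmod_diff[OF reverse_cubic_power
            eqmod_mult[OF eqmod_mult[OF eqmod_refl reverse_cubic_power] eqmod_refl]]
          eqmod_mult[OF eqmod_mult[OF eqmod_refl reverse_cubic_power] Z]])
  then show ?thesis unfolding expand middle last psi2_def by (simp only: mult.assoc)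
qed

lemma reverse_second_generator:
  "eqmod M' (cP (inverse ((- \<alpha>0) ^ k)) * xP ^ (3 * k) * flip (uP * (xP ^ 3 - cP \<alpha>0) ^ k)) (uP * V ^ k)"
proof -
  have "cP (inverse ((- \<alpha>0) ^ k)) * xP ^ (3 * k) * flip (uP * (xP ^ 3 - cP \<alpha>0) ^ k)
      = cP (inverse ((- \<alpha>0) ^ k)) * uP * (xP ^ (3 * k) * flip ((xP ^ 3 - cP \<alpha>0) ^ k))"
    by (simp only: invert_x_mult flip_atoms mult_ac)
  also have "eqmod M' \<dots> (cP (inverse ((- \<alpha>0) ^ k)) * uP * (cP ((- \<alpha>0) ^ k) * V ^ k))"
    by (rule eqmod_mult[OF eqmod_refl reverse_cubic_power])
  also have "\<dots> = (cP (inverse ((- \<alpha>0) ^ k)) * cP ((- \<alpha>0) ^ k)) * (uP * V ^ k)"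
    by (simp only: mult_ac)
  also have "cP (inverse ((- \<alpha>0) ^ k)) * cP ((- \<alpha>0) ^ k) = 1"
    using \<alpha>0 by (simp add: cP_mult[symmetric] cP_1)
  finally show ?thesis by simp
qed

end

lemma uv_unit_dvd_1:
  fixes a b c d :: "'a::field"
  assumes "a \<noteq> 0"
  shows "UV a b c d dvd 1"
proof -
  have "UV a b c d * UV (inverse a) (- b / a ^ 2) (- c / a ^ 2) (2 * b * c / a ^ 3 - d / a ^ 2) = 1"
    using assms by (simp add: one_uvring_def field_simps power2_eq_square power3_eq_cube)
  then show ?thesis by (metis dvd_triv_left)
qed

text \<open>
  One statement serves all cases of the theorem: the case \<open>z = 0\<close> arises from zero coefficients.
\<close>

lemma annihilator_star_generators:
  fixes n q l t mu :: nat and \<alpha>0 \<alpha>1 \<alpha>2 \<alpha>3 \<alpha>4 :: "'a::field" and \<alpha> :: "'a uvring"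
    and z0 z1 z2 :: "nat \<Rightarrow> 'a"
  assumes alpha: "\<alpha> = uv_const \<alpha>1 + uv_const \<alpha>2 * uu + uv_const \<alpha>3 * vv + uv_const \<alpha>4 * uu * vv"
    and nz: "\<alpha>3 \<noteq> 0" "\<alpha>0 \<noteq> 0" "\<alpha>1 \<noteq> 0" and n: "0 < n"
    and wq: "(Polynomial.monom 1 1 ^ 3 - [:\<alpha>0:]) ^ q = Polynomial.monom 1 1 ^ n - [:\<alpha>1:]"
    and bounds: "l \<le> 2 * q" "mu \<le> q" "mu \<le> l" "t \<le> l" "mu + l \<le> 2 * q + t"
    and z: "eqmod (consta_modulus n \<alpha>) z
      (\<Sum>k<mu - t. (cP (z0 k) * xP\<^sup>2 + cP (z1 k) * xP + cP (z2 k)) * (xP ^ 3 - cP \<alpha>0) ^ k)"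
  shows "annihilator_star n \<alpha> (consta_ideal n \<alpha>
      {(xP ^ 3 - cP \<alpha>0) ^ l + uP * (xP ^ 3 - cP \<alpha>0) ^ t * z, uP * (xP ^ 3 - cP \<alpha>0) ^ mu})
    = consta_ideal n (unit_inv \<alpha>) {psi2 q \<alpha>0 \<alpha>2 l t mu z0 z1 z2,
        uP * (xP ^ 3 - cP (inverse \<alpha>0)) ^ (2 * q - l)}"
proof -
  interpret uv_modulus n \<alpha>1 \<alpha>2 \<alpha>3 \<alpha>4 \<alpha>
    by unfold_locales (use alpha nz n in auto)
  note wq = wq[folded W0_def]
  let ?w = "xP ^ 3 - cP \<alpha>0"
  let ?Z = "\<Sum>k<mu - t. (cP (z0 k) * xP\<^sup>2 + cP (z1 k) * xP + cP (z2 k)) * ?w ^ k"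
  let ?I = "consta_ideal n \<alpha> {?w ^ l + uP * ?w ^ t * z, uP * ?w ^ mu}"
  let ?\<beta> = "unit_inv \<alpha>" and ?M' = "consta_modulus n (unit_inv \<alpha>)"
  have "\<alpha> dvd 1" unfolding alpha UV_eq[symmetric] by (rule uv_unit_dvd_1[OF nz(3)])
  then have \<beta>: "\<alpha> * ?\<beta> = 1" by (rule unit_inv_right)
  then interpret cubic_reversal n \<alpha> ?\<beta> \<alpha>0 by unfold_locales (use n nz in auto)
  let ?p = "Polynomial.monom 1 1 ^ 3 - [:\<alpha>0:]"
  have p0: "?p \<noteq> 0"
  proof -
    have "Polynomial.coeff ?p 3 = 1" by (simp add: monom_power coeff_pCons split: nat.splits)
    then show ?thesis by (metis coeff_0 zero_neq_one)
  qed
  have gen: "eqmod (consta_modulus n \<alpha>) (1 * (?w ^ l + uP * ?w ^ t * z)) (?w ^ l + uP * ?w ^ t * ?Z)"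
    unfolding mult_1 by (intro eqmod_add eqmod_mult eqmod_refl z)
  have I: "?I = consta_ideal n \<alpha> {?w ^ l + uP * ?w ^ t * ?Z, uP * ?w ^ mu}"
    by (rule consta_ideal_unit_multiples[OF gen, of 1 1 _ _ 1]) simp_all
  have sub: "?I \<subseteq> carrier (consta_ring n \<alpha>)"
    by (auto simp: consta_ideal_two_gens consta_ring_carrier)
  let ?G = "?w ^ (2 * q - mu) - 2 * cP \<alpha>2 * uP * ?w ^ (q - mu) - uP * ?w ^ (2 * q + t - l - mu) * ?Z"
  let ?H = "uP * ?w ^ (2 * q - l)"
  have "annihilator (consta_ring n \<alpha>) ?I = consta_ideal n \<alpha> {?G, ?H}"
    unfolding I unfolding x_cube_minus
    by (rule annihilator_generators[OF wq p0]) (use bounds in auto)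
  then have "annihilator_star n \<alpha> ?I = consta_ideal n ?\<beta> {invert_x n \<alpha> ?G, invert_x n \<alpha> ?H}"
    by (rule annihilator_star_two_gens[OF \<beta> refl n sub])
  also have "\<dots> = consta_ideal n ?\<beta> {psi2 q \<alpha>0 \<alpha>2 l t mu z0 z1 z2,
      uP * (xP ^ 3 - cP (inverse \<alpha>0)) ^ (2 * q - l)}"
  proof (rule consta_ideal_unit_multiples)
    let ?y = "invert_x n \<alpha> xP" and ?c = "(- \<alpha>0) ^ (2 * q - l)"
    show "eqmod ?M' (xP ^ (3 * (2 * q - mu)) * invert_x n \<alpha> ?G) (psi2 q \<alpha>0 \<alpha>2 l t mu z0 z1 z2)"
      by (rule reverse_first_generator[OF bounds(2-5)])
    show "eqmod ?M' (?y ^ (3 * (2 * q - mu)) * xP ^ (3 * (2 * q - mu))) 1"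
      using x_power_flip by (simp only: mult.commute)
    show "eqmod ?M' (cP (inverse ?c) * xP ^ (3 * (2 * q - l)) * invert_x n \<alpha> ?H)
        (uP * (xP ^ 3 - cP (inverse \<alpha>0)) ^ (2 * q - l))"
      by (rule reverse_second_generator)
    have "cP ?c * ?y ^ (3 * (2 * q - l)) * (cP (inverse ?c) * xP ^ (3 * (2 * q - l)))
        = (cP ?c * cP (inverse ?c)) * (xP ^ (3 * (2 * q - l)) * ?y ^ (3 * (2 * q - l)))"
      by (simp only: mult_ac)
    also have "cP ?c * cP (inverse ?c) = 1" using nz(2) by (simp add: cP_mult[symmetric] cP_1)
    finally show "eqmod ?M' (cP ?c * ?y ^ (3 * (2 * q - l)) * (cP (inverse ?c) * xP ^ (3 * (2 * q - l)))) 1"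
      using x_power_flip by simp
  qed
  finally show ?thesis .
qed


section \<open>The dual codes\<close>

theorem theorem5p5:
  fixes p m s q0 r0 l t mu n :: nat
    and \<alpha>0 \<alpha>1 \<alpha>2 \<alpha>3 \<alpha>4 :: "'a::{field,finite}"
    and \<alpha> :: "'a uvring"
    and z :: "'a uvring poly"
    and z0 z1 z2 :: "nat \<Rightarrow> 'a"
    and Q :: "'a uvring poly set ring"
    and C :: "'a uvring poly set set"
  assumes "prime p" and "p \<noteq> 3" and "odd p" and "m > 0" and "s > 0"
    and "CARD('a) = p ^ m"
    and "s = q0 * m + r0" and "r0 \<le> m - 1"
    and "\<alpha>1 \<noteq> 0" and "\<alpha>2 \<noteq> 0" and "\<alpha>3 \<noteq> 0"
    and "\<alpha>0 = \<alpha>1 ^ (p ^ (m - r0))"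
    and "\<alpha> = uv_const \<alpha>1 + uv_const \<alpha>2 * uu + uv_const \<alpha>3 * vv + uv_const \<alpha>4 * uu * vv"
    and "\<not> (\<exists>\<beta>. \<alpha> = \<beta> ^ 3)"
    and "n = 3 * p ^ s"
    and "Q = consta_ring n \<alpha>"
    and "l \<le> 2 * p ^ s - 1" and "t < l"
    and "consta_class n \<alpha> z = \<zero>\<^bsub>Q\<^esub> \<or> consta_class n \<alpha> z \<in> Units Q"
    and "mu < (if consta_class n \<alpha> z = \<zero>\<^bsub>Q\<^esub> then min l (p ^ s)
               else if l \<noteq> p ^ s + t then min l (min (p ^ s) (2 * p ^ s - l + t))
               else p ^ s)"
    and "consta_class n \<alpha> z \<in> Units Q \<Longrightarrow>
           consta_class n \<alpha> z =
             consta_class n \<alpha>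
               (\<Sum>k<mu - t. (cP (z0 k) * xP\<^sup>2 + cP (z1 k) * xP + cP (z2 k)) * (xP ^ 3 - cP \<alpha>0) ^ k) \<and>
           cP (z0 0) * xP\<^sup>2 + cP (z1 0) * xP + cP (z2 0) \<noteq> 0"
    and "C = consta_ideal n \<alpha>
               {(xP ^ 3 - cP \<alpha>0) ^ l + uP * (xP ^ 3 - cP \<alpha>0) ^ t * z, uP * (xP ^ 3 - cP \<alpha>0) ^ mu}"
  shows "(dual_code n (consta_code n \<alpha> C) = consta_code n (unit_inv \<alpha>) (annihilator_star n \<alpha> C)) \<and>
    (consta_class n \<alpha> z = \<zero>\<^bsub>Q\<^esub> \<and> 1 \<le> l \<and> l \<le> p ^ s \<longrightarrow>
           annihilator_star n \<alpha> C =
             consta_ideal n (unit_inv \<alpha>)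
               {psi1 (p ^ s) \<alpha>0 \<alpha>2 mu, uP * (xP ^ 3 - cP (inverse \<alpha>0)) ^ (2 * p ^ s - l)}) \<and>
    (consta_class n \<alpha> z \<in> Units Q \<and> l \<noteq> p ^ s + t \<longrightarrow>
           annihilator_star n \<alpha> C =
             consta_ideal n (unit_inv \<alpha>)
               {psi2 (p ^ s) \<alpha>0 \<alpha>2 l t mu z0 z1 z2,
                uP * (xP ^ 3 - cP (inverse \<alpha>0)) ^ (2 * p ^ s - l)}) \<and>
    (consta_class n \<alpha> z \<in> Units Q \<and> l = p ^ s + t \<longrightarrow>
           annihilator_star n \<alpha> C =
             consta_ideal n (unit_inv \<alpha>)
               {psi4 (p ^ s) \<alpha>0 \<alpha>2 l t mu z0 z1 z2,
                uP * (xP ^ 3 - cP (inverse \<alpha>0)) ^ (2 * p ^ s - l)})"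
proof -
  let ?q = "p ^ s"
  have q: "0 < ?q" using \<open>prime p\<close> by (simp add: prime_gt_0_nat)
  have n: "0 < n" using \<open>n = 3 * p ^ s\<close> q by simp
  have \<alpha>0: "\<alpha>0 \<noteq> 0" using \<open>\<alpha>0 = \<alpha>1 ^ (p ^ (m - r0))\<close> \<open>\<alpha>1 \<noteq> 0\<close> by simp
  have wq: "(Polynomial.monom 1 1 ^ 3 - [:\<alpha>0:]) ^ ?q = Polynomial.monom 1 1 ^ n - [:\<alpha>1:]"
    unfolding \<open>n = 3 * p ^ s\<close>
    by (rule x_cube_minus_power[OF \<open>prime p\<close> \<open>CARD('a) = p ^ m\<close> \<open>s = q0 * m + r0\<close> \<open>r0 \<le> m - 1\<close>
          \<open>\<alpha>0 = \<alpha>1 ^ (p ^ (m - r0))\<close>])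
  have l2: "l \<le> 2 * ?q" using \<open>l \<le> 2 * p ^ s - 1\<close> by simp
  have tl: "t \<le> l" using \<open>t < l\<close> by simp
  note star = annihilator_star_generators[OF \<open>\<alpha> = _\<close> \<open>\<alpha>3 \<noteq> 0\<close> \<alpha>0 \<open>\<alpha>1 \<noteq> 0\<close> n wq l2 _ _ tl]
  have \<beta>: "\<alpha> * unit_inv \<alpha> = 1"
  proof (rule unit_inv_right)
    show "\<alpha> dvd 1" unfolding \<open>\<alpha> = _\<close> UV_eq[symmetric] by (rule uv_unit_dvd_1[OF \<open>\<alpha>1 \<noteq> 0\<close>])
  qed
  have dual: "dual_code n (consta_code n \<alpha> C) = consta_code n (unit_inv \<alpha>) (annihilator_star n \<alpha> C)"
    unfolding \<open>C = _\<close> by (rule dual_code_eq_annihilator_star[OF \<beta> refl n consta_ideal_is_ideal])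
  \<comment> \<open>The quotient ring is nontrivial, so the two alternatives for \<open>z\<close> exclude each other.\<close>
  have units: "consta_class n \<alpha> z \<noteq> \<zero>\<^bsub>Q\<^esub>" if "consta_class n \<alpha> z \<in> Units Q"
  proof
    assume 0: "consta_class n \<alpha> z = \<zero>\<^bsub>Q\<^esub>"
    interpret Q: cring Q unfolding \<open>Q = _\<close> by (rule consta_ring_cring)
    have "\<one>\<^bsub>Q\<^esub> = \<zero>\<^bsub>Q\<^esub>" using that unfolding 0 by (metis Q.Units_r_inv_ex Q.l_null)
    then have "consta_modulus n \<alpha> dvd 1"
      unfolding \<open>Q = _\<close> consta_class_one consta_class_zero consta_class_eq_iff by (simp add: eqmod_def)
    then show False using consta_modulus_not_dvd[of 1 n \<alpha>] n by simp
  qed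
  have unit_case: "annihilator_star n \<alpha> C = consta_ideal n (unit_inv \<alpha>)
      {psi2 ?q \<alpha>0 \<alpha>2 l t mu z0 z1 z2, uP * (xP ^ 3 - cP (inverse \<alpha>0)) ^ (2 * ?q - l)}"
    if "consta_class n \<alpha> z \<in> Units Q"
    unfolding \<open>C = _\<close>
  proof (rule star)
    have "mu < (if l \<noteq> ?q + t then min l (min ?q (2 * ?q - l + t)) else ?q)"
      using \<open>mu < _\<close> units[OF that] by simp
    then show "mu \<le> ?q" "mu \<le> l" "mu + l \<le> 2 * ?q + t" using l2 by (auto split: if_splits)
    show "eqmod (consta_modulus n \<alpha>) z
      (\<Sum>k<mu - t. (cP (z0 k) * xP\<^sup>2 + cP (z1 k) * xP + cP (z2 k)) * (xP ^ 3 - cP \<alpha>0) ^ k)"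
      using assms(21)[OF that] by (simp add: consta_class_eq_iff)
  qed
  have zero_case: "annihilator_star n \<alpha> C = consta_ideal n (unit_inv \<alpha>)
      {psi1 ?q \<alpha>0 \<alpha>2 mu, uP * (xP ^ 3 - cP (inverse \<alpha>0)) ^ (2 * ?q - l)}"
    if "consta_class n \<alpha> z = \<zero>\<^bsub>Q\<^esub>" "l \<le> ?q"
  proof -
    have mu: "mu < l" using \<open>mu < _\<close> that by simp
    have "annihilator_star n \<alpha> C = consta_ideal n (unit_inv \<alpha>)
        {psi2 ?q \<alpha>0 \<alpha>2 l t mu (\<lambda>_. 0) (\<lambda>_. 0) (\<lambda>_. 0),
         uP * (xP ^ 3 - cP (inverse \<alpha>0)) ^ (2 * ?q - l)}"
      unfolding \<open>C = _\<close>
    proof (rule star)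
      show "mu \<le> ?q" "mu \<le> l" "mu + l \<le> 2 * ?q + t" using mu that(2) by auto
      show "eqmod (consta_modulus n \<alpha>) z
        (\<Sum>k<mu - t. (cP 0 * xP\<^sup>2 + cP 0 * xP + cP 0) * (xP ^ 3 - cP \<alpha>0) ^ k)"
        using that(1) unfolding \<open>Q = _\<close> consta_class_zero by (simp add: consta_class_eq_iff cP_0)
    qed
    also have "psi2 ?q \<alpha>0 \<alpha>2 l t mu (\<lambda>_. 0) (\<lambda>_. 0) (\<lambda>_. 0) = psi1 ?q \<alpha>0 \<alpha>2 mu"
      by (simp add: psi1_def psi2_def cP_0)
    finally show ?thesis .
  qed
  have "psi4 = (psi2 :: nat \<Rightarrow> 'a \<Rightarrow> _)" by (intro ext) (simp add: psi2_def psi4_def)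
  then show ?thesis using dual unit_case zero_case by simp
qed

end
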